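(* Let $n\in\mathbb{N}$ ($n\ge 1$), $z_0\in\mathbb{D}$ and $\gamma=(\gamma_0,\ldots,\gamma_{n-1})\in\overline{\mathbb{D}}^{\,n}$. Suppose that $f\in\mathcal{H}$ satisfies $f(z_0)=\gamma_0$, $H^1f(z_0)=\gamma_1,\ldots,H^{n-1}f(z_0)=\gamma_{n-1}$. Let $c_n=c_n(z_0,\gamma_0,\ldots,\gamma_{n-1})\in\mathbb{C}$ and $\rho_n=\rho_n(z_0,\gamma_0,\ldots,\gamma_{n-1})\ge 0$ be the quantities defined in the context. (1) If $|\gamma_1|<1,\ldots,|\gamma_{j-1}|<1$, $|\gamma_j|=1$, $\gamma_{j+1}=\cdots=\gamma_{n-1}=0$ for some $j\in\{1,\ldots,n-1\}$, then $f^{(n)}(z_0)=c_n$ and $$f(z)=T_{\gamma_0}\bigl(T_{-z_0}(z)\,T_{\gamma_1}(\cdots T_{-z_0}(z)\,T_{\gamma_{j-1}}(\gamma_j T_{-z_0}(z))\cdots)\bigr),$$ which is a Blaschke product of degree $j$. (2) If $|\gamma_1|<1,\ldots,|\gamma_{n-1}|<1$, then the region of values of $f^{(n)}(z_0)$ (i.e. the set of all values $f^{(n)}(z_0)$ as $f$ ranges over all functions in $\mathcal{H}$ with $f(z_0)=\gamma_0$ and $H^kf(z_0)=\gamma_k$ for $1\le k\le n-1$) is the closed disk $$\overline{\mathbb{D}}(c_n,\rho_n)=\{f^{(n)}_{\gamma,\varepsilon}(z_0):\varepsilon\in\overline{\mathbb{D}}\},$$ where $$f_{\gamma,\varepsilon}(z)=T_{\gamma_0}\bigl(T_{-z_0}(z)\,T_{\gamma_1}(\cdots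 T_{-z_0}(z)\,T_{\gamma_{n-1}}(\varepsilon T_{-z_0}(z))\cdots)\bigr),$$ and every such $f$ has the form $$f(z)=T_{\gamma_0}\bigl(T_{-z_0}(z)\,T_{\gamma_1}(\cdots T_{-z_0}(z)\,T_{\gamma_{n-1}}(T_{-z_0}(z)f^*(z))\cdots)\bigr)$$ for some $f^*\in\mathcal{S}$. Further, $f^{(n)}(z_0)\in\partial\mathbb{D}(c_n,\rho_n)$ if and only if $f=f_{\gamma,\varepsilon}$ for some constant $\varepsilon\in\partial\mathbb{D}$.
   Context: Notation. $\mathbb{D}$, $\overline{\mathbb{D}}$ are the open and closed unit disks in $\mathbb{C}$; $\mathbb{D}(c,\rho)$, $\overline{\mathbb{D}}(c,\rho)$ are the open and closed disks with center $c$ and radius $\rho$. $\mathcal{H}$ is the class of analytic self-maps $\mathbb{D}\to\mathbb{D}$; $\mathcal{S}$ is the class of analytic functions from $\mathbb{D}$ to $\overline{\mathbb{D}}$. For $a\in\mathbb{D}$, $T_a(z)=(z+a)/(1+\bar a z)$. For $z,w$ put $[z,w]=\dfrac{z-w}{1-\bar w z}$. A Blaschke product of degree $j$ is a function $e^{i\theta}\prod_{i=1}^{j}[z,z_i]$ with $\theta\in\mathbb{R}$, $z_i\in\mathbb{D}$. Hyperbolic derivatives. For $z_0\in\mathbb{D}$ and $f\in\mathcal{H}$ define $\Delta_{z_0}f\in\mathcal{S}$ by $\Delta_{z_0}f(z)=[f(z),f(z_0)]/[z,z_0]$ for $z\ne z_0$ and $\Delta_{z_0}f(z_0)=(1-|z_0|^2)f'(z_0)/(1-|f(z_0)|^2)$.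 Iterating, $\Delta_{z_0}^kf=(\Delta_{z_0}\circ\cdots\circ\Delta_{z_0})f$ ($k$ times), and the $k$-th order hyperbolic derivative of $f$ at $z_0$ is $H^kf(z_0)=(\Delta_{z_0}^kf)(z_0)$. Convention: if some $\Delta^j_{z_0}f$ is a unimodular constant (which happens exactly when $f$ is a Blaschke product of degree $j$), then $H^kf(z_0):=0$ for all $k>j$. The functions $F_n$, $G_n$. Set $F_1(\gamma_1)=\gamma_1$, $F_2(\gamma_1,\gamma_2)=(1-|\gamma_1|^2)\gamma_2$, and for $n\ge3$ $$F_n(\gamma_1,\ldots,\gamma_n)=(1-|\gamma_1|^2)F_{n-1}(\gamma_2,\ldots,\gamma_n)-\bar\gamma_1\sum_{k=2}^{n-1}F_{n-k}(\gamma_2,\ldots,\gamma_{n-k+1})F_k(\gamma_1,\ldots,\gamma_k).$$ Set $G_1:=0$ and, for $n\ge2$, $G_n(\gamma_1,\ldots,\gamma_{n-1})=F_n(\gamma_1,\ldots,\gamma_n)-(1-|\gamma_1|^2)\cdots(1-|\gamma_{n-1}|^2)\gamma_n$ (the right side does not depend on $\gamma_n$). Coefficients and Bell polynomials. For $1\le k\le n$, $\alpha_{n,k}=(-1)^{n-k}\dfrac{n!\,(n-1)!}{k!\,(k-1)!\,(n-k)!}$, and $$A_{n,k}(x_1,\ldots,x_{n-k+1})=n!\sum\prod_{i=1}^{n-k+1}\frac{x_i^{j_i}}{(i!)^{j_i}\,j_i!},$$ the sum being over all integers $j_1,\ldots,j_{n-k+1}\ge0$ with $\sum_i j_i=k$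 and $\sum_i i\,j_i=n$. The quantities $c_n,\rho_n$. For $n\ge1$, $$\rho_n=\frac{n!\prod_{k=0}^{n-1}(1-|\gamma_k|^2)}{(1-|z_0|^2)^n},\qquad c_n=\frac{1-|\gamma_0|^2}{(1-|z_0|^2)^n}\bigl[n!\,G_n(\gamma_1,\ldots,\gamma_{n-1})-s_{n-1}\bigr],$$ where $s_0:=0$ and, for $n\ge2$, $$s_{n-1}=\sum_{k=1}^{n-1}\alpha_{n,k}\frac{(\overline{z_0})^{n-k}(1-|z_0|^2)^k\,p_k}{1-|\gamma_0|^2}-\sum_{k=2}^{n}k!\,(-\overline{\gamma_0})^{k-1}A_{n,k}(d_1,\ldots,d_{n-k+1}),$$ with $d_k=k!\,F_k(\gamma_1,\ldots,\gamma_k)$ and (recursively) $p_k=c_k+\rho_k\gamma_k$ for $1\le k\le n-1$. (For $f$ with the prescribed data, $d_k$ is the Peschl invariant derivative $D^kf(z_0)$ and $p_k=f^{(k)}(z_0)$, so $s_{n-1}$ depends only on $z_0,\gamma_0,\ldots,\gamma_{n-1}$.) *)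

theory Defs
  imports "HOL-Complex_Analysis.Complex_Analysis"
begin

definition class_H :: "(complex \<Rightarrow> complex) set" where
  "class_H = {f. f holomorphic_on ball 0 1 \<and> f ` ball 0 1 \<subseteq> ball 0 1}"

definition class_S :: "(complex \<Rightarrow> complex) set" where
  "class_S = {f. f holomorphic_on ball 0 1 \<and> f ` ball 0 1 \<subseteq> cball 0 1}"

definition disk_aut :: "complex \<Rightarrow> complex \<Rightarrow> complex" where
  "disk_aut a z = (z + a) / (1 + cnj a * z)"

definition hbracket :: "complex \<Rightarrow> complex \<Rightarrow> complex" where
  "hbracket z w = (z - w) / (1 - cnj w * z)"

definition blaschke_product :: "nat \<Rightarrow> (complex \<Rightarrow> complex) \<Rightarrow> bool" where
  "blaschke_product j f \<longleftrightarrow>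
     (\<exists>(\<theta>::real) (a :: nat \<Rightarrow> complex). (\<forall>i\<in>{1..j}. a i \<in> ball 0 1) \<and>
        (\<forall>z\<in>ball 0 1. f z = cis \<theta> * (\<Prod>i=1..j. hbracket z (a i))))"

definition hyp_quot :: "complex \<Rightarrow> (complex \<Rightarrow> complex) \<Rightarrow> complex \<Rightarrow> complex" where
  "hyp_quot z0 f z =
     (if z = z0
      then of_real (1 - (cmod z0)\<^sup>2) * deriv f z0 / of_real (1 - (cmod (f z0))\<^sup>2)
      else hbracket (f z) (f z0) / hbracket z z0)"

definition unimodular_const :: "(complex \<Rightarrow> complex) \<Rightarrow> bool" where
  "unimodular_const f \<longleftrightarrow> (\<exists>c. cmod c = 1 \<and> (\<forall>z\<in>ball 0 1. f z = c))"

(* Once an iterate is a unimodular constant it has left the class of self-maps of the open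
   disk; the hyperbolic derivatives of higher order are then 0 by convention. *)
definition hyp_deriv :: "nat \<Rightarrow> (complex \<Rightarrow> complex) \<Rightarrow> complex \<Rightarrow> complex" where
  "hyp_deriv k f z0 =
     (if \<exists>j<k. unimodular_const ((hyp_quot z0 ^^ j) f) then 0 else (hyp_quot z0 ^^ k) f z0)"

definition hyp_data_class :: "nat \<Rightarrow> complex \<Rightarrow> (nat \<Rightarrow> complex) \<Rightarrow> (complex \<Rightarrow> complex) set" where
  "hyp_data_class n z0 \<gamma> =
     {f \<in> class_H. f z0 = \<gamma> 0 \<and> (\<forall>k\<in>{1..n-1}. hyp_deriv k f z0 = \<gamma> k)}"

(* hyp_F n \<gamma> is F_n(\<gamma>_1, ..., \<gamma>_n): arguments are read from index 1 on, so dropping the first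
   argument is the shift \<lambda>i. \<gamma> (i + 1).  The value at n = 0 is a dummy. *)
fun hyp_F :: "nat \<Rightarrow> (nat \<Rightarrow> complex) \<Rightarrow> complex" where
  "hyp_F n \<gamma> =
     (if n = 0 then 0
      else if n = 1 then \<gamma> 1
      else if n = 2 then of_real (1 - (cmod (\<gamma> 1))\<^sup>2) * \<gamma> 2
      else of_real (1 - (cmod (\<gamma> 1))\<^sup>2) * hyp_F (n - 1) (\<lambda>i. \<gamma> (i + 1))
           - cnj (\<gamma> 1) * (\<Sum>k=2..n-1. hyp_F (n - k) (\<lambda>i. \<gamma> (i + 1)) * hyp_F k \<gamma>))"

declare hyp_F.simps [simp del]

(* The value does not depend on \<gamma> n; see hyp_G_cong. *)
definition hyp_G :: "nat \<Rightarrow> (nat \<Rightarrow> complex) \<Rightarrow> complex" where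
  "hyp_G n \<gamma> =
     (if n \<le> 1 then 0
      else hyp_F n \<gamma> - of_real (\<Prod>k=1..n-1. 1 - (cmod (\<gamma> k))\<^sup>2) * \<gamma> n)"

lemma hyp_F_cong:
  assumes "\<And>i. 1 \<le> i \<Longrightarrow> i \<le> n \<Longrightarrow> \<gamma> i = \<delta> i"
  shows "hyp_F n \<gamma> = hyp_F n \<delta>"
  using assms
proof (induction n arbitrary: \<gamma> \<delta> rule: less_induct)
  case (less n)
  consider "n \<le> 2" | "n \<ge> 3" by linarith
  then show ?case
  proof cases
    case 1
    then show ?thesis using less.prems by (auto simp: hyp_F.simps[of n])
  next
    case 2
    have "hyp_F (n - k) (\<lambda>i. \<gamma> (i + 1)) = hyp_F (n - k) (\<lambda>i. \<delta> (i + 1))" if "1 \<le> k" for k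
      using that 2 by (intro less.IH) (auto intro!: less.prems)
    moreover have "hyp_F k \<gamma> = hyp_F k \<delta>" if "k \<in> {2..n-1}" for k
      using that 2 by (intro less.IH) (auto intro!: less.prems)
    moreover have "\<gamma> 1 = \<delta> 1" using 2 less.prems by simp
    ultimately show ?thesis
      using 2 by (simp add: hyp_F.simps[of n])
  qed
qed

lemma hyp_G_cong:
  assumes "\<And>i. 1 \<le> i \<Longrightarrow> i < n \<Longrightarrow> \<gamma> i = \<delta> i"
  shows "hyp_G n \<gamma> = hyp_G n \<delta>"
  using assms
proof (induction n arbitrary: \<gamma> \<delta> rule: less_induct)
  case (less n)
  consider "n \<le> 1" | "n = 2" | "n \<ge> 3" by linarith
  then show ?case
  proof cases
    case 1
    then show ?thesis by (simp add: hyp_G_def)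
  next
    case 2
    then show ?thesis by (simp add: hyp_G_def hyp_F.simps[of 2])
  next
    case 3
    have P: "(\<Prod>k=1..n-1. 1 - (cmod (\<eta> k))\<^sup>2) =
        (1 - (cmod (\<eta> 1))\<^sup>2) * (\<Prod>k=1..n-1-1. 1 - (cmod (\<eta> (k + 1)))\<^sup>2)" for \<eta> :: "nat \<Rightarrow> complex"
    proof -
      obtain m where m: "n = Suc (Suc m)" using 3 by (intro that[of "n - 2"]) simp
      have "(\<Prod>k=1..Suc m. 1 - (cmod (\<eta> k))\<^sup>2) =
          (1 - (cmod (\<eta> 1))\<^sup>2) * (\<Prod>k=Suc 1..Suc m. 1 - (cmod (\<eta> k))\<^sup>2)"
        by (rule prod.atLeast_Suc_atMost) simp
      also have "(\<Prod>k=Suc 1..Suc m. 1 - (cmod (\<eta> k))\<^sup>2) = (\<Prod>k=1..m. 1 - (cmod (\<eta> (Suc k)))\<^sup>2)"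
        by (rule prod.shift_bounds_cl_Suc_ivl)
      finally show ?thesis by (simp add: m)
    qed
    have E: "hyp_G n \<eta> = of_real (1 - (cmod (\<eta> 1))\<^sup>2) * hyp_G (n - 1) (\<lambda>i. \<eta> (i + 1))
        - cnj (\<eta> 1) * (\<Sum>k=2..n-1. hyp_F (n - k) (\<lambda>i. \<eta> (i + 1)) * hyp_F k \<eta>)" for \<eta>
      using 3 unfolding hyp_G_def P by (simp add: hyp_F.simps[of n] algebra_simps)
    have "hyp_F (n - k) (\<lambda>i. \<gamma> (i + 1)) = hyp_F (n - k) (\<lambda>i. \<delta> (i + 1))" if "2 \<le> k" for k
      using that 3 by (intro hyp_F_cong) (auto intro!: less.prems)
    moreover have "hyp_F k \<gamma> = hyp_F k \<delta>" if "k \<in> {2..n-1}" for k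
      using that 3 by (intro hyp_F_cong) (auto intro!: less.prems)
    moreover have "\<gamma> 1 = \<delta> 1" using 3 less.prems by simp
    moreover have "hyp_G (n - 1) (\<lambda>i. \<gamma> (i + 1)) = hyp_G (n - 1) (\<lambda>i. \<delta> (i + 1))"
      using 3 by (intro less.IH) (auto intro!: less.prems)
    ultimately show ?thesis
      unfolding E by simp
  qed
qed

definition hyp_alpha :: "nat \<Rightarrow> nat \<Rightarrow> complex" where
  "hyp_alpha n k =
     (-1) ^ (n - k) * (fact n * fact (n - 1) / (fact k * fact (k - 1) * fact (n - k)))"

(* The exponent tuples (j_1, ..., j_(n-k+1)) of the partial Bell polynomial. *)
definition bell_index :: "nat \<Rightarrow> nat \<Rightarrow> (nat \<Rightarrow> nat) set" where
  "bell_index n k =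
     {j \<in> {1..n-k+1} \<rightarrow>\<^sub>E UNIV. (\<Sum>i=1..n-k+1. j i) = k \<and> (\<Sum>i=1..n-k+1. i * j i) = n}"

lemma finite_bell_index: "finite (bell_index n k)"
proof (rule finite_subset)
  show "bell_index n k \<subseteq> {1..n-k+1} \<rightarrow>\<^sub>E {..k}"
  proof
    fix j assume j: "j \<in> bell_index n k"
    have "j i \<le> k" if "i \<in> {1..n-k+1}" for i
      using j that member_le_sum[of i "{1..n-k+1}" j] by (simp add: bell_index_def)
    then show "j \<in> {1..n-k+1} \<rightarrow>\<^sub>E {..k}"
      using j by (auto simp: bell_index_def PiE_iff)
  qed
qed (simp add: finite_PiE)

definition bell_poly :: "nat \<Rightarrow> nat \<Rightarrow> (nat \<Rightarrow> complex) \<Rightarrow> complex" where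
  "bell_poly n k x =
     fact n * (\<Sum>j\<in>bell_index n k. \<Prod>i=1..n-k+1. x i ^ j i / (fact i ^ j i * fact (j i)))"

definition hyp_rho :: "nat \<Rightarrow> complex \<Rightarrow> (nat \<Rightarrow> complex) \<Rightarrow> real" where
  "hyp_rho n z0 \<gamma> =
     fact n * (\<Prod>k<n. 1 - (cmod (\<gamma> k))\<^sup>2) / (1 - (cmod z0)\<^sup>2) ^ n"

definition hyp_d :: "(nat \<Rightarrow> complex) \<Rightarrow> nat \<Rightarrow> complex" where
  "hyp_d \<gamma> k = fact k * hyp_F k \<gamma>"

(* hyp_s m is s_m (so n = m + 1 in its defining formula) and the subterm
   hyp_c k z0 \<gamma> + hyp_rho k z0 \<gamma> * \<gamma> k is p_k.  The value of hyp_c at 0 is a dummy. *)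
function hyp_c :: "nat \<Rightarrow> complex \<Rightarrow> (nat \<Rightarrow> complex) \<Rightarrow> complex"
  and hyp_s :: "nat \<Rightarrow> complex \<Rightarrow> (nat \<Rightarrow> complex) \<Rightarrow> complex" where
  "hyp_c n z0 \<gamma> =
     (if n = 0 then 0
      else of_real ((1 - (cmod (\<gamma> 0))\<^sup>2) / (1 - (cmod z0)\<^sup>2) ^ n)
             * (fact n * hyp_G n \<gamma> - hyp_s (n - 1) z0 \<gamma>))"
| "hyp_s m z0 \<gamma> =
     (if m = 0 then 0
      else (\<Sum>k=1..m. hyp_alpha (m + 1) k * cnj z0 ^ (m + 1 - k) * of_real ((1 - (cmod z0)\<^sup>2) ^ k)
                * (hyp_c k z0 \<gamma> + of_real (hyp_rho k z0 \<gamma>) * \<gamma> k)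
                / of_real (1 - (cmod (\<gamma> 0))\<^sup>2))
           - (\<Sum>k=2..m+1. fact k * (- cnj (\<gamma> 0)) ^ (k - 1) * bell_poly (m + 1) k (hyp_d \<gamma>)))"
  by pat_completeness auto
termination
  by (relation "Wellfounded.measure (case_sum (\<lambda>(n, _). 2 * n) (\<lambda>(m, _). 2 * m + 1))") auto

declare hyp_c.simps [simp del] hyp_s.simps [simp del]

(* Writing T_a for disk_aut a, nested_aut z0 [g_0, ..., g_(m-1)] w z is
   T_(g_0)(T_(-z0)(z) T_(g_1)(... T_(-z0)(z) T_(g_(m-1))(T_(-z0)(z) w) ...)). *)
primrec nested_aut :: "complex \<Rightarrow> complex list \<Rightarrow> complex \<Rightarrow> complex \<Rightarrow> complex" where
  "nested_aut z0 [] w z = w"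
| "nested_aut z0 (g # gs) w z = disk_aut g (disk_aut (- z0) z * nested_aut z0 gs w z)"

definition extremal :: "nat \<Rightarrow> complex \<Rightarrow> (nat \<Rightarrow> complex) \<Rightarrow> complex \<Rightarrow> complex \<Rightarrow> complex" where
  "extremal n z0 \<gamma> \<epsilon> = nested_aut z0 (map \<gamma> [0..<n]) \<epsilon>"

end

(*
  Schur's algorithm: writing f = T_(f z0) (T_(-z0) * h) with h = hyp_quot z0 f, the Schwarz lemma
  puts h into the class S, and the process can be repeated until a unimodular constant appears.
  Hence n steps turn f into a free parameter h in S whose value at z0 is the n-th hyperbolic
  derivative, and the coefficient recursion of the algorithm is the recursion defining F_n.
  Expanding f o T_(z0) in the two ways f o T_(z0) = T_(f z0) o g, with g the function f centred at
  z0 and f z0, expresses the n-th derivative of f at z0 as c_n + rho_n * H^n f(z0).  All assertions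
  then follow because H^n f(z0) runs through the closed unit disk and attains modulus 1 only if
  the free parameter is constant.
*)

theory Submission
  imports Defs "HOL-Computational_Algebra.Fundamental_Theorem_Algebra"
begin

text \<open>The constants arise from substitution of power series. Powers of
  \<open>T_(z0) - z0\<close> are monomials times negative binomial series, the source of
  \<open>hyp_alpha\<close>; powers of \<open>g\<close> give the partial Bell polynomials. At order
  \<open>n\<close> the identity contains just two terms of top order, the \<open>n\<close>-th
  derivative of \<open>f\<close> and the \<open>n\<close>-th coefficient of \<open>g\<close>, so it
  can be solved for the derivative. That coefficient is \<open>hyp_F n\<close>, affine in its last
  argument with slope the product of the \<open>1 - |\<gamma>_k|^2\<close>; with the factor
  \<open>1 - |\<gamma>_0|^2\<close> from \<open>T_(f z0)\<close> and normalising constants this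
  becomes the radius.

  The obstacle is the boundary of the disk: a Schur step takes \<open>class_H\<close> into the
  larger \<open>class_S\<close>. The maximum principle leaves only unimodular constants as new
  functions, and the centred series of such a constant is 0, in agreement with the convention for
  its later hyperbolic derivatives.

  That nested expressions are Blaschke products needs a separate argument: a disk automorphism must
  preserve Blaschke products and their degree, and the new zeros come from the fundamental theorem
  of algebra.\<close>

unbundle no vec_syntax

subsection \<open>The Schur algorithm\<close>

lemma disk_aut_eq_Moebius: "disk_aut a = Moebius_function 0 (- a)"
  by (simp add: disk_aut_def Moebius_function_simple fun_eq_iff)

lemma hbracket_eq_disk_aut: "hbracket z w = disk_aut (- w) z"
  by (simp add: disk_aut_def hbracket_def)

lemma disk_aut_denominator_nonzero:
  assumes "cmod a < 1" "cmod z \<le> 1"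
  shows "1 + cnj a * z \<noteq> 0"
proof
  assume "1 + cnj a * z = 0"
  then have "cnj a * z = -1"
    by (simp add: eq_neg_iff_add_eq_0 add.commute)
  then have "cmod a * cmod z = 1"
    by (metis complex_mod_cnj norm_minus_cancel norm_mult norm_one)
  moreover have "cmod a * cmod z \<le> cmod a * 1"
    using assms by (intro mult_left_mono) auto
  ultimately show False using assms by simp
qed

lemma norm_disk_aut_less_1:
  "cmod a < 1 \<Longrightarrow> cmod z < 1 \<Longrightarrow> cmod (disk_aut a z) < 1"
  by (simp add: disk_aut_eq_Moebius Moebius_function_norm_lt_1)

lemma disk_aut_inverse:
  "cmod a < 1 \<Longrightarrow> cmod z < 1 \<Longrightarrow> disk_aut a (disk_aut (- a) z) = z"
  unfolding disk_aut_eq_Moebius by (rule Moebius_function_compose) auto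

lemma disk_aut_inverse':
  "cmod a < 1 \<Longrightarrow> cmod z < 1 \<Longrightarrow> disk_aut (- a) (disk_aut a z) = z"
  using disk_aut_inverse[of "- a" z] by simp

lemma holomorphic_on_disk_aut: "cmod a < 1 \<Longrightarrow> disk_aut a holomorphic_on ball 0 1"
  by (simp add: disk_aut_eq_Moebius Moebius_function_holomorphic)

lemma disk_aut_0 [simp]: "disk_aut a 0 = a"
  by (simp add: disk_aut_def)

lemma disk_aut_minus_self [simp]: "disk_aut (- a) a = 0"
  by (simp add: disk_aut_def)

lemma holomorphic_on_disk_aut_compose:
  assumes "cmod a < 1" "g holomorphic_on ball 0 1" "\<And>z. z \<in> ball 0 1 \<Longrightarrow> cmod (g z) < 1"
  shows "(\<lambda>z. disk_aut a (g z)) holomorphic_on ball 0 1"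
proof -
  have "(disk_aut a \<circ> g) holomorphic_on ball 0 1"
    using assms by (intro holomorphic_on_compose_gen[OF _ holomorphic_on_disk_aut]) auto
  then show ?thesis by (simp add: comp_def)
qed

lemma disk_aut_minus_eq_0_iff:
  "cmod a < 1 \<Longrightarrow> cmod z < 1 \<Longrightarrow> disk_aut (- a) z = 0 \<longleftrightarrow> z = a"
  using disk_aut_denominator_nonzero[of "- a" z] by (simp add: disk_aut_def)

section \<open>Self-maps of the disk and the maximum principle\<close>

lemma class_H_subset_class_S: "class_H \<subseteq> class_S"
  unfolding class_H_def class_S_def using ball_subset_cball by blast

lemma class_H_norm: "f \<in> class_H \<Longrightarrow> z \<in> ball 0 1 \<Longrightarrow> cmod (f z) < 1"
  by (auto simp: class_H_def image_subset_iff)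

lemma class_S_norm: "f \<in> class_S \<Longrightarrow> z \<in> ball 0 1 \<Longrightarrow> cmod (f z) \<le> 1"
  by (auto simp: class_S_def image_subset_iff)

text \<open>A value of modulus 1 is an interior maximum of the modulus. This yields the dichotomy
  used throughout: a member of \<open>class_S\<close> lies in \<open>class_H\<close> or is a
  unimodular constant on the disk.\<close>

lemma class_S_constant:
  assumes f: "f \<in> class_S" and z: "z \<in> ball 0 1" and "cmod (f z) = 1" and w: "w \<in> ball 0 1"
  shows "f w = f z"
proof -
  have "f constant_on ball 0 1"
  proof (rule maximum_modulus_principle)
    show "f holomorphic_on ball 0 1" using f by (simp add: class_S_def)
    show "cmod (f u) \<le> cmod (f z)" if "u \<in> ball 0 1" for u
      using class_S_norm[OF f that] assms by simp
  qed (use z in auto)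
  then show ?thesis using z w by (metis constant_on_def)
qed

lemma class_S_unimodular:
  assumes "f \<in> class_S" "z \<in> ball 0 1" "cmod (f z) = 1"
  shows "unimodular_const f"
  unfolding unimodular_const_def using class_S_constant[OF assms] assms(3) by blast

lemma class_S_imp_class_H:
  assumes f: "f \<in> class_S" and z: "z \<in> ball 0 1" and "cmod (f z) < 1"
  shows "f \<in> class_H"
proof -
  have "cmod (f w) < 1" if w: "w \<in> ball 0 1" for w
  proof (rule ccontr)
    assume "\<not> cmod (f w) < 1"
    then have "cmod (f w) = 1" using class_S_norm[OF f w] by simp
    from class_S_constant[OF f w this z] this assms(3) show False by simp
  qed
  then show ?thesis using f by (auto simp: class_H_def class_S_def)
qed

lemma class_H_not_unimodular: "f \<in> class_H \<Longrightarrow> \<not> unimodular_const f"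
  unfolding unimodular_const_def
  by (metis centre_in_ball class_H_norm less_irrefl zero_less_one)

lemma DERIV_disk_aut:
  assumes "cmod a < 1" "cmod z < 1"
  shows "(disk_aut a has_field_derivative (1 - of_real ((cmod a)\<^sup>2)) / (1 + cnj a * z)\<^sup>2) (at z)"
proof -
  have nz: "1 + cnj a * z \<noteq> 0" using assms by (intro disk_aut_denominator_nonzero) auto
  have "((\<lambda>z. (z + a) / (1 + cnj a * z)) has_field_derivative
      (1 * (1 + cnj a * z) - (z + a) * cnj a) / ((1 + cnj a * z) * (1 + cnj a * z))) (at z)"
    using nz by (intro DERIV_divide derivative_eq_intros) auto
  moreover have "1 * (1 + cnj a * z) - (z + a) * cnj a = 1 - of_real ((cmod a)\<^sup>2)"
    unfolding complex_norm_square by (simp add: algebra_simps)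
  ultimately show ?thesis
    by (simp only: disk_aut_def[abs_def] power2_eq_square[of "1 + cnj a * z"])
qed

section \<open>Centring at the origin and the Schwarz lemma\<close>

lemma centred_in_class_H:
  assumes "f \<in> class_H" "z0 \<in> ball 0 1"
  shows "(\<lambda>u. disk_aut (- f z0) (f (disk_aut z0 u))) \<in> class_H"
proof -
  note fH = assms(1)
  have z0: "cmod z0 < 1" using assms by simp
  have f0: "cmod (- f z0) < 1" using class_H_norm[OF assms] by simp
  have hol: "(\<lambda>u. f (disk_aut z0 u)) holomorphic_on ball 0 1"
  proof -
    have "disk_aut z0 ` ball 0 1 \<subseteq> ball 0 1" using norm_disk_aut_less_1[OF z0] by auto
    then show ?thesis
      using holomorphic_on_compose_gen[OF holomorphic_on_disk_aut[OF z0], of f "ball 0 1"] fH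
      by (simp add: class_H_def comp_def)
  qed
  have nrm: "cmod (f (disk_aut z0 u)) < 1" if "u \<in> ball 0 1" for u
    using class_H_norm[OF fH] norm_disk_aut_less_1[OF z0] that by simp
  show ?thesis
    using holomorphic_on_disk_aut_compose[OF f0 hol nrm] norm_disk_aut_less_1[OF f0 nrm]
    by (auto simp: class_H_def)
qed

text \<open>Moving \<open>z0\<close> and \<open>f z0\<close> to the origin turns \<open>hyp_quot\<close> into \<open>g u / u\<close>, to which the Schwarz
  lemma applies.\<close>
lemma centred_quotient:
  assumes f: "f \<in> class_H" and z0: "z0 \<in> ball 0 1"
  defines "g \<equiv> \<lambda>u. disk_aut (- f z0) (f (disk_aut z0 u))"
  obtains h where "h \<in> class_S" "\<And>u. u \<in> ball 0 1 \<Longrightarrow> g u = u * h u"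
    "\<And>z. z \<in> ball 0 1 \<Longrightarrow> hyp_quot z0 f z = h (disk_aut (- z0) z)"
proof -
  have gH: "g \<in> class_H" unfolding g_def by (rule centred_in_class_H[OF f z0])
  then have hol: "g holomorphic_on ball 0 1" by (simp add: class_H_def)
  have nrm: "cmod (g u) < 1" if "cmod u < 1" for u using class_H_norm[OF gH] that by simp
  have g0: "g 0 = 0" by (simp add: g_def)
  have z0': "cmod z0 < 1" "cmod (- z0) < 1" using z0 by auto
  have fz0: "cmod (f z0) < 1" using class_H_norm[OF f z0] .
  obtain h where h: "h holomorphic_on ball 0 1" "\<And>u. cmod u < 1 \<Longrightarrow> g u = u * h u"
    "deriv g 0 = h 0"
    using Schwarz3[OF hol g0] by blast
  have "cmod (h u) \<le> 1" if u: "cmod u < 1" for u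
  proof (cases "u = 0")
    case True
    then show ?thesis using Schwarz_Lemma(2)[OF hol g0 nrm, of 0] h(3) by simp
  next
    case False
    have "cmod u * cmod (h u) \<le> cmod u * 1"
      using Schwarz_Lemma(1)[OF hol g0 nrm u] h(2)[OF u] by (simp add: norm_mult)
    then show ?thesis using False by simp
  qed
  then have "h \<in> class_S" using h(1) by (auto simp: class_S_def)
  moreover have "hyp_quot z0 f z = h (disk_aut (- z0) z)" if z: "z \<in> ball 0 1" for z
  proof (cases "z = z0")
    case False
    have zz: "cmod (disk_aut (- z0) z) < 1" using norm_disk_aut_less_1[OF z0'(2)] z by simp
    have "disk_aut (- z0) z \<noteq> 0" using disk_aut_minus_eq_0_iff[OF z0'(1)] z False by simp
    moreover have "disk_aut (- f z0) (f z) = disk_aut (- z0) z * h (disk_aut (- z0) z)"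
      using h(2)[OF zz] disk_aut_inverse[OF z0'(1), of z] z by (simp add: g_def)
    ultimately show ?thesis
      using False by (simp add: hyp_quot_def hbracket_eq_disk_aut)
  next
    case True
    \<comment> \<open>At \<open>z0\<close> the Schwarz quotient equals \<open>deriv g 0\<close>. By
      the chain rule the outer automorphism contributes
      \<open>(1 - |f z0|^2) / (1 - |f z0|^2)^2\<close>, which reduces to the denominator in
      \<open>hyp_quot_def\<close>.\<close>
    have "f field_differentiable at z0"
      using f z0 by (auto simp: class_H_def intro: holomorphic_on_imp_differentiable_at)
    then have "(f has_field_derivative deriv f z0) (at (disk_aut z0 0))"
      by (simp add: DERIV_deriv_iff_field_differentiable)
    from DERIV_chain2[OF this DERIV_disk_aut[OF z0'(1), of 0]]
    have "((\<lambda>u. f (disk_aut z0 u)) has_field_derivative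
        deriv f z0 * (1 - of_real ((cmod z0)\<^sup>2))) (at 0)"
      by simp
    moreover have "(disk_aut (- f z0) has_field_derivative
        (1 - of_real ((cmod (f z0))\<^sup>2)) / (1 + cnj (- f z0) * f z0)\<^sup>2) (at (f (disk_aut z0 0)))"
      using DERIV_disk_aut[of "- f z0" "f z0"] fz0 by simp
    ultimately have "(g has_field_derivative (1 - of_real ((cmod (f z0))\<^sup>2)) / (1 + cnj (- f z0) * f z0)\<^sup>2 *
        (deriv f z0 * (1 - of_real ((cmod z0)\<^sup>2)))) (at 0)"
      unfolding g_def by (rule DERIV_chain2[rotated])
    moreover have "1 + cnj (- f z0) * f z0 = 1 - of_real ((cmod (f z0))\<^sup>2)"
      unfolding complex_norm_square by simp
    ultimately have "deriv g 0 = (1 - of_real ((cmod z0)\<^sup>2)) * deriv f z0 /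
        (1 - of_real ((cmod (f z0))\<^sup>2))"
      by (simp add: DERIV_imp_deriv power2_eq_square)
    then show ?thesis using True h(3) by (simp add: hyp_quot_def)
  qed
  ultimately show thesis using that h(2) by auto
qed

text \<open>The singularity at \<open>z0\<close> is removable: on the whole disk, \<open>z0\<close>
  included, the quotient is a Schwarz quotient composed with \<open>disk_aut (- z0)\<close>.\<close>

lemma hyp_quot_in_class_S:
  assumes f: "f \<in> class_H" and z0: "z0 \<in> ball 0 1"
  shows "hyp_quot z0 f \<in> class_S"
proof -
  obtain h where h: "h \<in> class_S"
    "\<And>z. z \<in> ball 0 1 \<Longrightarrow> hyp_quot z0 f z = h (disk_aut (- z0) z)"
    using centred_quotient[OF f z0] by metis
  have m: "cmod (- z0) < 1" using z0 by simp
  have "(h \<circ> disk_aut (- z0)) holomorphic_on ball 0 1"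
    using h(1) norm_disk_aut_less_1[OF m]
    by (intro holomorphic_on_compose_gen[OF holomorphic_on_disk_aut[OF m]])
       (auto simp: class_S_def)
  then have "hyp_quot z0 f holomorphic_on ball 0 1"
    by (rule holomorphic_transform) (use h in auto)
  then show ?thesis
    using class_S_norm[OF h(1)] norm_disk_aut_less_1[OF m] h(2) by (auto simp: class_S_def)
qed

lemma schur_step:
  assumes f: "f \<in> class_H" and z0: "z0 \<in> ball 0 1" and z: "z \<in> ball 0 1"
  shows "f z = disk_aut (f z0) (disk_aut (- z0) z * hyp_quot z0 f z)"
proof (cases "z = z0")
  case False
  have "disk_aut (- z0) z \<noteq> 0" using disk_aut_minus_eq_0_iff z z0 False by simp
  then have "disk_aut (- z0) z * hyp_quot z0 f z = disk_aut (- f z0) (f z)"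
    using False by (simp add: hyp_quot_def hbracket_eq_disk_aut)
  then show ?thesis
    using disk_aut_inverse[of "f z0" "f z"] class_H_norm[OF f z0] class_H_norm[OF f z] by simp
qed simp

lemma norm_disk_aut_mult_less_1:
  assumes "z0 \<in> ball 0 1" "z \<in> ball 0 1" "cmod w \<le> 1"
  shows "cmod (disk_aut (- z0) z * w) < 1"
proof -
  have "cmod (disk_aut (- z0) z) * cmod w \<le> cmod (disk_aut (- z0) z) * 1"
    using assms by (intro mult_left_mono) auto
  then show ?thesis
    using norm_disk_aut_less_1[of "- z0" z] assms by (simp add: norm_mult)
qed

lemma schur_step_in_class_H:
  assumes a: "cmod a < 1" and z0: "z0 \<in> ball 0 1" and h: "h \<in> class_S"
  shows "(\<lambda>z. disk_aut a (disk_aut (- z0) z * h z)) \<in> class_H"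
proof -
  have *: "cmod (disk_aut (- z0) z * h z) < 1" if "z \<in> ball 0 1" for z
    using norm_disk_aut_mult_less_1[OF z0 that class_S_norm[OF h that]] .
  have "(\<lambda>z. disk_aut (- z0) z * h z) holomorphic_on ball 0 1"
    using h holomorphic_on_disk_aut[of "- z0"] z0
    by (intro holomorphic_on_mult) (auto simp: class_S_def)
  from holomorphic_on_disk_aut_compose[OF a this *] norm_disk_aut_less_1[OF a *]
  show ?thesis by (auto simp: class_H_def)
qed

text \<open>Away from \<open>z0\<close> the outer automorphism is inverted and the nonzero factor
  \<open>disk_aut (- z0) z\<close> cancelled. At \<open>z0\<close> both sides are continuous, so
  agreement on a punctured neighbourhood decides.\<close>

lemma hyp_quot_schur_step:
  assumes a: "cmod a < 1" and z0: "z0 \<in> ball 0 1" and h: "h \<in> class_S" and z: "z \<in> ball 0 1"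
  defines "f \<equiv> \<lambda>z. disk_aut a (disk_aut (- z0) z * h z)"
  shows "hyp_quot z0 f z = h z"
proof -
  have f: "f \<in> class_H" unfolding f_def by (rule schur_step_in_class_H[OF a z0 h])
  have fz0: "f z0 = a" by (simp add: f_def)
  have off: "hyp_quot z0 f z = h z" if z: "z \<in> ball 0 1" "z \<noteq> z0" for z
  proof -
    have "disk_aut (- z0) z \<noteq> 0" using disk_aut_minus_eq_0_iff z z0 by simp
    moreover have "disk_aut (- a) (f z) = disk_aut (- z0) z * h z"
      unfolding f_def
      using disk_aut_inverse'[OF a norm_disk_aut_mult_less_1[OF z0 z(1) class_S_norm[OF h z(1)]]] .
    ultimately show ?thesis
      using z by (simp add: hyp_quot_def hbracket_eq_disk_aut fz0)
  qed
  have "hyp_quot z0 f z0 = h z0"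
  proof -
    define d where "d = (\<lambda>z. hyp_quot z0 f z - h z)"
    have "d holomorphic_on ball 0 1"
      using hyp_quot_in_class_S[OF f z0] h unfolding d_def
      by (intro holomorphic_intros) (auto simp: class_S_def)
    then have "isCont d z0"
      using z0 by (meson continuous_on_eq_continuous_at holomorphic_on_imp_continuous_on open_ball)
    moreover have "\<forall>\<^sub>F z in at z0. z \<in> ball 0 1 \<and> z \<noteq> z0"
      using eventually_nhds_in_open[OF open_ball z0]
      by (auto simp: eventually_at_filter elim: eventually_mono)
    then have "\<forall>\<^sub>F z in at z0. d z = 0"
      by (rule eventually_mono) (auto simp: d_def off)
    ultimately have "d z0 = 0"
      by (metis at_neq_bot isContD tendsto_eventually tendsto_unique)
    then show ?thesis by (simp add: d_def)
  qed
  with off z show ?thesis by blast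
qed

section \<open>Hyperbolic derivatives: locality and iteration\<close>

lemma hyp_quot_cong:
  assumes "\<And>z. z \<in> ball 0 1 \<Longrightarrow> f z = g z" "z0 \<in> ball 0 1" "z \<in> ball 0 1"
  shows "hyp_quot z0 f z = hyp_quot z0 g z"
proof -
  have "\<forall>\<^sub>F z in nhds z0. f z = g z"
    using eventually_nhds_in_open[of "ball 0 1" z0] assms
    by (auto elim: eventually_mono)
  then have "deriv f z0 = deriv g z0" by (rule deriv_cong_ev) simp
  then show ?thesis using assms by (simp add: hyp_quot_def)
qed

lemma hyp_quot_funpow_cong:
  assumes "\<And>z. z \<in> ball 0 1 \<Longrightarrow> f z = g z" "z0 \<in> ball 0 1" "z \<in> ball 0 1"
  shows "(hyp_quot z0 ^^ k) f z = (hyp_quot z0 ^^ k) g z"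
  using assms(3)
proof (induction k arbitrary: z)
  case (Suc k)
  then show ?case using assms(2) by (auto intro!: hyp_quot_cong)
qed (use assms in simp)

lemma hyp_deriv_cong:
  assumes "\<And>z. z \<in> ball 0 1 \<Longrightarrow> f z = g z" "z0 \<in> ball 0 1"
  shows "hyp_deriv k f z0 = hyp_deriv k g z0"
proof -
  have *: "(hyp_quot z0 ^^ k) f z = (hyp_quot z0 ^^ k) g z" if "z \<in> ball 0 1" for k z
    using assms that by (auto intro!: hyp_quot_funpow_cong)
  have "unimodular_const ((hyp_quot z0 ^^ j) f) = unimodular_const ((hyp_quot z0 ^^ j) g)" for j
    unfolding unimodular_const_def using * by auto
  then show ?thesis using *[OF assms(2)] by (simp only: hyp_deriv_def)
qed

lemma hyp_deriv_0 [simp]: "hyp_deriv 0 f z0 = f z0"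
  by (simp add: hyp_deriv_def)

text \<open>Membership in \<open>class_H\<close> excludes the index \<open>j = 0\<close> from the
  unimodularity test, so the remaining tests are those of the quotient, shifted by one.\<close>

lemma hyp_deriv_Suc:
  assumes "f \<in> class_H"
  shows "hyp_deriv (Suc k) f z0 = hyp_deriv k (hyp_quot z0 f) z0"
proof -
  have "(\<exists>j<Suc k. unimodular_const ((hyp_quot z0 ^^ j) f)) \<longleftrightarrow>
      (\<exists>j<k. unimodular_const ((hyp_quot z0 ^^ j) (hyp_quot z0 f)))"
    using class_H_not_unimodular[OF assms]
    by (auto simp: Ex_less_Suc2 funpow_Suc_right simp del: funpow.simps)
  then show ?thesis
    by (simp only: hyp_deriv_def funpow_Suc_right comp_def)
qed

lemma hyp_deriv_unimodular:
  assumes "unimodular_const f"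
  shows "hyp_deriv (Suc k) f z0 = 0"
  using assms unfolding hyp_deriv_def by (metis funpow_0 zero_less_Suc)

text \<open>Stated for \<open>class_S\<close> because the induction passes to the quotient, which
  may be a unimodular constant; there the convention supplies the value 0.\<close>

lemma norm_hyp_deriv_le_1:
  assumes "z0 \<in> ball 0 1" "f \<in> class_S"
  shows "cmod (hyp_deriv k f z0) \<le> 1"
  using assms(2)
proof (induction k arbitrary: f)
  case (Suc k)
  show ?case
  proof (cases "cmod (f z0) = 1")
    case True
    then show ?thesis
      using class_S_unimodular[OF Suc.prems assms(1)] by (simp add: hyp_deriv_unimodular)
  next
    case False
    then have "f \<in> class_H"
      using class_S_imp_class_H[OF Suc.prems assms(1)] class_S_norm[OF Suc.prems assms(1)] by simp
    then show ?thesis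
      using Suc.IH[OF hyp_quot_in_class_S[OF _ assms(1)]] by (simp add: hyp_deriv_Suc)
  qed
qed (use class_S_norm assms in auto)

section \<open>Nested automorphisms and the free parameter\<close>

text \<open>Each step peels off the outermost automorphism and shifts the data by one. The strict
  bound on \<open>\<gamma> 0\<close> keeps the current function in \<open>class_H\<close>, whereas
  the final parameter \<open>h\<close> may be a unimodular constant.\<close>

lemma nested_aut_representation:
  assumes "z0 \<in> ball 0 1" "f \<in> class_S" "\<And>k. k < n \<Longrightarrow> hyp_deriv k f z0 = \<gamma> k"
    "\<And>k. k < n \<Longrightarrow> cmod (\<gamma> k) < 1"
  obtains h where "h \<in> class_S" "h z0 = hyp_deriv n f z0"
    "\<And>z. z \<in> ball 0 1 \<Longrightarrow> f z = nested_aut z0 (map \<gamma> [0..<n]) (h z) z"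
  using assms(2-)
proof (induction n arbitrary: f \<gamma> thesis)
  case 0
  then show ?case by (auto intro: "0.prems"(1)[of f])
next
  case (Suc n)
  have f0: "f z0 = \<gamma> 0" using Suc.prems(3)[of 0] by simp
  have f: "f \<in> class_H"
    using class_S_imp_class_H[OF Suc.prems(2) assms(1)] f0 Suc.prems(4) by simp
  note q = hyp_quot_in_class_S[OF f assms(1)]
  have d: "hyp_deriv k (hyp_quot z0 f) z0 = \<gamma> (Suc k)" if "k < n" for k
    using Suc.prems(3)[of "Suc k"] that by (simp add: hyp_deriv_Suc[OF f])
  obtain h where h: "h \<in> class_S" "h z0 = hyp_deriv n (hyp_quot z0 f) z0"
    "\<And>z. z \<in> ball 0 1 \<Longrightarrow>
      hyp_quot z0 f z = nested_aut z0 (map (\<lambda>k. \<gamma> (Suc k)) [0..<n]) (h z) z"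
    using Suc.IH[OF _ q d] Suc.prems(4) by auto
  have "map \<gamma> [0..<Suc n] = \<gamma> 0 # map (\<lambda>k. \<gamma> (Suc k)) [0..<n]"
    by (simp only: upt_conv_Cons zero_less_Suc map_Suc_upt[symmetric]) simp
  then have "f z = nested_aut z0 (map \<gamma> [0..<Suc n]) (h z) z" if "z \<in> ball 0 1" for z
    using schur_step[OF f assms(1) that] h(3)[OF that] by (simp add: f0)
  then show ?case using Suc.prems(1)[OF h(1)] h(2) by (simp add: hyp_deriv_Suc[OF f])
qed

lemma nested_aut_in_class_S:
  assumes "z0 \<in> ball 0 1" "h \<in> class_S" "\<forall>g\<in>set gs. cmod g < 1"
  shows "(\<lambda>z. nested_aut z0 gs (h z) z) \<in> class_S"
  using assms(3)
proof (induction gs)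
  case (Cons g gs)
  then show ?case
    using schur_step_in_class_H[OF _ assms(1), of g] class_H_subset_class_S by auto
qed (use assms in simp)

text \<open>The converse of the representation: nesting produces the prescribed data. Appending
  \<open>h z0\<close> to the list lets one formula also cover \<open>k = length gs\<close>, where
  the free parameter becomes visible.\<close>

lemma hyp_deriv_nested_aut:
  assumes "z0 \<in> ball 0 1" "h \<in> class_S" "\<forall>g\<in>set gs. cmod g < 1" "k \<le> length gs"
  shows "hyp_deriv k (\<lambda>z. nested_aut z0 gs (h z) z) z0 = (gs @ [h z0]) ! k"
  using assms(3,4)
proof (induction gs arbitrary: k)
  case (Cons g gs)
  let ?N = "\<lambda>z. nested_aut z0 gs (h z) z"
  have N: "?N \<in> class_S" using nested_aut_in_class_S[OF assms(1,2)] Cons.prems by simp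
  have g: "cmod g < 1" using Cons.prems by simp
  show ?case
  proof (cases k)
    case (Suc m)
    have "hyp_deriv k (\<lambda>z. nested_aut z0 (g # gs) (h z) z) z0 =
        hyp_deriv m (hyp_quot z0 (\<lambda>z. disk_aut g (disk_aut (- z0) z * ?N z))) z0"
      using schur_step_in_class_H[OF g assms(1) N] by (simp add: Suc hyp_deriv_Suc)
    also have "\<dots> = hyp_deriv m ?N z0"
      by (rule hyp_deriv_cong) (use hyp_quot_schur_step[OF g assms(1) N] assms(1) in auto)
    finally show ?thesis using Cons Suc by simp
  qed simp
qed simp

subsection \<open>Bell polynomials as coefficients of powers\<close>

lemma fps_power_nth_cong:
  fixes a b :: "'a :: comm_semiring_1 fps"
  assumes "\<And>i. i \<le> m \<Longrightarrow> a $ i = b $ i"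
  shows "(a ^ k) $ m = (b ^ k) $ m"
  using assms
proof (induction k arbitrary: m)
  case (Suc k)
  have "(a ^ k) $ i = (b ^ k) $ i" if "i \<le> m" for i
    using that Suc.prems by (intro Suc.IH) auto
  then show ?case by (simp add: fps_mult_nth Suc.prems)
qed simp

text \<open>Division by \<open>fact k\<close> turns the binomial theorem into a plain convolution, a
  form that can be iterated over the summands.\<close>

lemma fps_divided_power_add:
  fixes x y :: "'a :: field_char_0 fps"
  shows "fps_const (1 / fact k) * (x + y) ^ k =
    (\<Sum>l\<le>k. (fps_const (1 / fact l) * x ^ l) * (fps_const (1 / fact (k - l)) * y ^ (k - l)))"
proof -
  have "fps_const (1 / fact k) * (of_nat (k choose l) * x ^ l * y ^ (k - l)) =
      (fps_const (1 / fact l) * x ^ l) * (fps_const (1 / fact (k - l)) * y ^ (k - l))"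
    if "l \<le> k" for l
  proof -
    have "fps_const (1 / fact k) * of_nat (k choose l) =
        fps_const (1 / fact l) * (fps_const (1 / fact (k - l)) :: 'a fps)"
      using that by (simp add: fps_of_nat[symmetric] binomial_fact field_simps)
    moreover have "fps_const (1 / fact k) * (of_nat (k choose l) * x ^ l * y ^ (k - l)) =
        (fps_const (1 / fact k) * of_nat (k choose l)) * (x ^ l * y ^ (k - l))"
      by (simp only: mult_ac)
    ultimately show ?thesis by (simp only: mult_ac)
  qed
  then show ?thesis
    unfolding binomial_ring sum_distrib_left by (intro sum.cong refl) (simp only: atMost_iff)
qed

lemma fps_multinomial:
  fixes x :: "'b \<Rightarrow> 'a :: field_char_0 fps"
  assumes "finite S"
  shows "fps_const (1 / fact k) * (\<Sum>i\<in>S. x i) ^ k =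
    (\<Sum>j | j \<in> S \<rightarrow>\<^sub>E UNIV \<and> sum j S = k. \<Prod>i\<in>S. fps_const (1 / fact (j i)) * x i ^ j i)"
  using assms
proof (induction S arbitrary: k rule: finite_induct)
  case empty
  then show ?case by (cases k) auto
next
  case (insert s S)
  define E where "E = (\<lambda>(S :: 'b set) k. {j. j \<in> S \<rightarrow>\<^sub>E (UNIV :: nat set) \<and> sum j S = k})"
  define t where "t = (\<lambda>i n. fps_const (1 / fact n) * x i ^ n)"
  have finE: "finite (E S m)" for m
  proof (rule finite_subset)
    show "E S m \<subseteq> S \<rightarrow>\<^sub>E {..m}"
      using insert.hyps(1) by (auto simp: E_def PiE_iff extensional_def intro: member_le_sum)
  qed (use insert.hyps(1) in \<open>simp add: finite_PiE\<close>)
  have upd: "sum (j(s := l)) S = sum j S" "(\<Prod>i\<in>S. t i ((j(s := l)) i)) = (\<Prod>i\<in>S. t i (j i))"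
    for j l using insert.hyps(2) by (auto intro!: sum.cong prod.cong)
  have "fps_const (1 / fact k) * (\<Sum>i\<in>insert s S. x i) ^ k =
      (\<Sum>l\<le>k. t s l * (fps_const (1 / fact (k - l)) * (\<Sum>i\<in>S. x i) ^ (k - l)))"
    using insert.hyps by (simp add: fps_divided_power_add t_def)
  also have "\<dots> = (\<Sum>l\<le>k. t s l * (\<Sum>j\<in>E S (k - l). \<Prod>i\<in>S. t i (j i)))"
    by (simp add: insert.IH E_def t_def)
  also have "\<dots> = (\<Sum>(l, j)\<in>Sigma {..k} (\<lambda>l. E S (k - l)). t s l * (\<Prod>i\<in>S. t i (j i)))"
    using finE by (simp add: sum_distrib_left sum.Sigma)
  also have "\<dots> = (\<Sum>j\<in>E (insert s S) k. \<Prod>i\<in>insert s S. t i (j i))"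
  \<comment> \<open>The bijection splits off the exponent at \<open>s\<close>. Resetting that entry
    to \<open>undefined\<close> keeps the remaining tuple extensional on \<open>S\<close>.\<close>
  proof (rule sum.reindex_bij_witness[where
        i = "\<lambda>j. (j s, j(s := undefined))" and j = "\<lambda>(l, j). j(s := l)"])
    fix j assume "j \<in> E (insert s S) k"
    then show "(j s, j(s := undefined)) \<in> Sigma {..k} (\<lambda>l. E S (k - l))"
      using insert.hyps upd(1)[of j undefined] by (auto simp: E_def PiE_iff extensional_def)
  qed (use insert.hyps upd in \<open>auto simp: E_def PiE_iff extensional_def fun_eq_iff\<close>)
  finally show ?case by (simp add: E_def t_def)
qed

text \<open>Only the coefficients \<open>1, ..., n - k + 1\<close> of \<open>a\<close> influence
  this coefficient. Truncating \<open>a\<close> to them gives a finite sum, and the multinomial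
  theorem then has exactly the index set of \<open>bell_poly\<close>; the factors
  \<open>fact i\<close> cancel those in its definition.\<close>

lemma fps_power_nth_eq_bell_poly:
  assumes "a $ 0 = 0" "1 \<le> k" "k \<le> n"
  shows "fact n * (a ^ k) $ n = fact k * bell_poly n k (\<lambda>i. fact i * a $ i)"
proof -
  define N where "N = n - k + 1"
  define b where "b = (\<Sum>i\<in>{1..N}. fps_const (a $ i) * fps_X ^ i)"
  have b_nth: "b $ i = (if i \<in> {1..N} then a $ i else 0)" for i
  proof -
    have "b $ i = (\<Sum>l\<in>{1..N}. if l = i then a $ l else 0)"
      unfolding b_def fps_sum_nth by (intro sum.cong) (auto simp: fps_X_power_nth)
    then show ?thesis by simp
  qed
  \<comment> \<open>One factor \<open>fps_X\<close> is taken out of each of the \<open>k\<close>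
    factors. What remains is a coefficient of index \<open>n - k\<close> of the shifted series,
    which reads the original one up to index \<open>n - k + 1\<close>.\<close>
  have shift: "(c ^ k) $ n = (fps_shift 1 c ^ k) $ (n - k)" if "c $ 0 = 0" for c :: "complex fps"
  proof -
    have "c = fps_X * fps_shift 1 c"
      using that by (auto simp: fps_eq_iff)
    then have "c ^ k = fps_X ^ k * fps_shift 1 c ^ k" by (metis power_mult_distrib)
    then show ?thesis using assms(3) by (simp add: fps_X_power_mult_nth)
  qed
  have "(a ^ k) $ n = (b ^ k) $ n"
    using shift[OF assms(1)] shift[of b] assms
    by (auto simp: b_nth N_def intro!: fps_power_nth_cong)
  also have "\<dots> = fact k * (fps_const (1 / fact k) * b ^ k) $ n" by simp
  also have "fps_const (1 / fact k) * b ^ k =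
      (\<Sum>j | j \<in> {1..N} \<rightarrow>\<^sub>E UNIV \<and> sum j {1..N} = k.
        \<Prod>i\<in>{1..N}. fps_const (1 / fact (j i)) * (fps_const (a $ i) * fps_X ^ i) ^ j i)"
    unfolding b_def by (rule fps_multinomial) simp
  also have "\<dots> = (\<Sum>j | j \<in> {1..N} \<rightarrow>\<^sub>E UNIV \<and> sum j {1..N} = k.
        fps_const (\<Prod>i\<in>{1..N}. (a $ i) ^ j i / fact (j i)) * fps_X ^ (\<Sum>i\<in>{1..N}. i * j i))"
  proof (intro sum.cong refl)
    fix j :: "nat \<Rightarrow> nat"
    have "(\<Prod>i\<in>{1..N}. fps_const (1 / fact (j i)) * (fps_const (a $ i) * fps_X ^ i) ^ j i) =
        (\<Prod>i\<in>{1..N}. fps_const ((a $ i) ^ j i / fact (j i)) * fps_X ^ (i * j i))"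
      by (intro prod.cong refl) (simp add: power_mult_distrib power_mult fps_const_power
          mult.assoc[symmetric])
    also have "\<dots> = (\<Prod>i\<in>{1..N}. fps_const ((a $ i) ^ j i / fact (j i))) *
        (\<Prod>i\<in>{1..N}. fps_X ^ (i * j i))"
      by (rule prod.distrib)
    also have "(\<Prod>i\<in>{1..N}. fps_const ((a $ i) ^ j i / fact (j i))) =
        fps_const (\<Prod>i\<in>{1..N}. (a $ i) ^ j i / fact (j i))"
      by (induction N) simp_all
    finally show "(\<Prod>i\<in>{1..N}. fps_const (1 / fact (j i)) * (fps_const (a $ i) * fps_X ^ i) ^ j i) =
        fps_const (\<Prod>i\<in>{1..N}. (a $ i) ^ j i / fact (j i)) * fps_X ^ (\<Sum>i\<in>{1..N}. i * j i)"
      by (simp add: power_sum)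
  qed
  also have "\<dots> $ n = (\<Sum>j | j \<in> {1..N} \<rightarrow>\<^sub>E UNIV \<and> sum j {1..N} = k.
        if (\<Sum>i\<in>{1..N}. i * j i) = n then \<Prod>i\<in>{1..N}. (a $ i) ^ j i / fact (j i) else 0)"
    unfolding fps_sum_nth by (intro sum.cong) (auto simp: fps_X_power_nth)
  also have "\<dots> = (\<Sum>j\<in>bell_index n k. \<Prod>i\<in>{1..N}. (a $ i) ^ j i / fact (j i))"
  proof (rule sum.mono_neutral_cong_right)
    show "finite {j. j \<in> {1..N} \<rightarrow>\<^sub>E UNIV \<and> sum j {1..N} = k}"
    proof (rule finite_subset)
      show "{j. j \<in> {1..N} \<rightarrow>\<^sub>E UNIV \<and> sum j {1..N} = k} \<subseteq> {1..N} \<rightarrow>\<^sub>E {..k}"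
      proof
        fix j assume j: "j \<in> {j. j \<in> {1..N} \<rightarrow>\<^sub>E UNIV \<and> sum j {1..N} = k}"
        then have "j i \<le> k" if "i \<in> {1..N}" for i
          using that member_le_sum[of i "{1..N}" j] by simp
        then show "j \<in> {1..N} \<rightarrow>\<^sub>E {..k}" using j by (auto simp: PiE_iff)
      qed
    qed (simp add: finite_PiE)
  qed (auto simp: bell_index_def N_def)
  finally have "fact n * (a ^ k) $ n =
      fact k * (fact n * (\<Sum>j\<in>bell_index n k. \<Prod>i\<in>{1..N}. (a $ i) ^ j i / fact (j i)))"
    by simp
  also have "fact n * (\<Sum>j\<in>bell_index n k. \<Prod>i\<in>{1..N}. (a $ i) ^ j i / fact (j i)) =
      bell_poly n k (\<lambda>i. fact i * a $ i)"
    by (simp add: bell_poly_def N_def power_mult_distrib)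
  finally show ?thesis .
qed

subsection \<open>Taylor coefficients and hyperbolic derivatives\<close>

lemma bell_poly_cong:
  "(\<And>i. 1 \<le> i \<Longrightarrow> i \<le> n - k + 1 \<Longrightarrow> x i = y i) \<Longrightarrow> bell_poly n k x = bell_poly n k y"
  by (simp add: bell_poly_def)

lemma has_fps_expansion_eventually:
  assumes "\<forall>\<^sub>F x in nhds 0. f x = g x" "g has_fps_expansion F"
  shows "f has_fps_expansion F"
  using has_fps_expansion_cong[OF assms(1) refl] assms(2) by blast

section \<open>Power series of disk automorphisms and of centred functions\<close>

text \<open>The Taylor series at 0 of \<open>disk_aut a z - a\<close>; without its constant term the
  series can be substituted into another one.\<close>

definition disk_aut_fps :: "complex \<Rightarrow> complex fps" where
  "disk_aut_fps a = fps_const (1 - of_real ((cmod a)\<^sup>2)) * fps_X * inverse (1 + fps_const (cnj a) * fps_X)"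

text \<open>The power is \<open>fps_X ^ k\<close> times a negative binomial series; its coefficient
  at \<open>m = n - k\<close> has \<open>k + m - 1 = n - 1\<close> as upper binomial index.\<close>

lemma disk_aut_fps_power_nth:
  assumes "1 \<le> k" "k \<le> n"
  shows "(disk_aut_fps a ^ k) $ n =
    (1 - of_real ((cmod a)\<^sup>2)) ^ k * of_nat ((n - 1) choose (n - k)) * (- cnj a) ^ (n - k)"
proof -
  have "disk_aut_fps a ^ k = fps_const ((1 - of_real ((cmod a)\<^sup>2)) ^ k) *
      (fps_X ^ k * inverse ((1 - fps_const (- cnj a) * fps_X) ^ k))"
    by (simp add: disk_aut_fps_def power_mult_distrib fps_const_power fps_inverse_power
        mult.assoc flip: fps_const_neg)
  also have "inverse ((1 - fps_const (- cnj a) * fps_X) ^ k) =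
      Abs_fps (\<lambda>m. of_nat ((k + m - 1) choose m) * (- cnj a) ^ m)"
    using assms by (intro one_minus_const_fps_X_neg_power') simp
  finally show ?thesis using assms by (simp add: fps_X_power_mult_nth)
qed

lemma disk_aut_fps_nth:
  "1 \<le> n \<Longrightarrow> disk_aut_fps a $ n = (1 - of_real ((cmod a)\<^sup>2)) * (- cnj a) ^ (n - 1)"
  using disk_aut_fps_power_nth[of 1 n a] by simp

lemma disk_aut_fps_nth_0 [simp]: "disk_aut_fps a $ 0 = 0"
  by (simp add: disk_aut_fps_def)

lemma has_fps_expansion_disk_aut:
  "(\<lambda>z. disk_aut a z - a) has_fps_expansion disk_aut_fps a"
proof -
  have "(\<lambda>z. (1 - of_real ((cmod a)\<^sup>2)) * z * inverse (1 + cnj a * z)) has_fps_expansion disk_aut_fps a"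
    unfolding disk_aut_fps_def by (intro fps_expansion_intros) simp
  moreover have "\<forall>\<^sub>F z in nhds 0. 1 + cnj a * z \<noteq> 0"
  proof -
    have "isCont (\<lambda>z. 1 + cnj a * z) 0" by (intro continuous_intros)
    then have "((\<lambda>z. 1 + cnj a * z) \<longlongrightarrow> 1) (nhds 0)" by (simp add: isCont_def tendsto_nhds_iff)
    then show ?thesis by (rule tendsto_imp_eventually_ne) simp
  qed
  then have "\<forall>\<^sub>F z in nhds 0. disk_aut a z - a = (1 - of_real ((cmod a)\<^sup>2)) * z * inverse (1 + cnj a * z)"
  proof (rule eventually_mono)
    fix z assume nz: "1 + cnj a * z \<noteq> 0"
    then have "disk_aut a z - a = (z + a - a * (1 + cnj a * z)) / (1 + cnj a * z)"
      by (simp add: disk_aut_def diff_divide_distrib)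
    also have "z + a - a * (1 + cnj a * z) = (1 - of_real ((cmod a)\<^sup>2)) * z"
      unfolding complex_norm_square by (simp add: algebra_simps)
    finally show "disk_aut a z - a = (1 - of_real ((cmod a)\<^sup>2)) * z * inverse (1 + cnj a * z)"
      by (simp add: divide_inverse)
  qed
  ultimately show ?thesis
    by (rule has_fps_expansion_eventually[rotated])
qed

text \<open>Brings \<open>hyp_alpha\<close> into the shape of the coefficients in
  \<open>disk_aut_fps_power_nth\<close>.\<close>

lemma hyp_alpha_eq_binomial:
  assumes "1 \<le> k" "k \<le> n"
  shows "hyp_alpha n k = (-1) ^ (n - k) * fact n / fact k * of_nat ((n - 1) choose (n - k))"
proof -
  have "n - 1 - (n - k) = k - 1" using assms by simp
  then show ?thesis using assms by (simp add: hyp_alpha_def binomial_fact field_simps)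
qed

text \<open>For \<open>f\<close> in \<open>class_H\<close>, \<open>fact k\<close> times the
  coefficient of index \<open>k\<close> is the Peschl invariant derivative of order \<open>k\<close>
  at \<open>z0\<close>.\<close>

definition centred_fps :: "complex \<Rightarrow> (complex \<Rightarrow> complex) \<Rightarrow> complex fps" where
  "centred_fps z0 f = fps_expansion (\<lambda>u. disk_aut (- f z0) (f (disk_aut z0 u))) 0"

lemma has_fps_expansion_centred_fps:
  assumes "f \<in> class_H" "z0 \<in> ball 0 1"
  shows "(\<lambda>u. disk_aut (- f z0) (f (disk_aut z0 u))) has_fps_expansion centred_fps z0 f"
  unfolding centred_fps_def
  using centred_in_class_H[OF assms] has_fps_expansion_fps_expansion[of "ball 0 1"]
  by (auto simp: class_H_def)

lemma centred_fps_nth_0 [simp]: "centred_fps z0 f $ 0 = 0"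
  by (simp add: centred_fps_def fps_expansion_def)

lemma eventually_unit_ball: "\<forall>\<^sub>F u :: complex in nhds 0. u \<in> ball 0 1"
  by (rule eventually_nhds_in_open) auto

text \<open>Both sides are \<open>fact n\<close> times the \<open>n\<close>-th Taylor coefficient at \<open>0\<close> of \<open>f \<circ> T_z0\<close>: the left
  side expands it as \<open>f\<close> after \<open>T_z0\<close>, the right side as \<open>T_(f z0)\<close> after the centred function.\<close>
lemma centred_expansion_identity:
  assumes f: "f \<in> class_H" and z0: "z0 \<in> ball 0 1" and "1 \<le> n"
  shows "(\<Sum>k=1..n. hyp_alpha n k * cnj z0 ^ (n - k) * (1 - of_real ((cmod z0)\<^sup>2)) ^ k * (deriv ^^ k) f z0) =
    (1 - of_real ((cmod (f z0))\<^sup>2)) *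
      (\<Sum>k=1..n. fact k * (- cnj (f z0)) ^ (k - 1) * bell_poly n k (\<lambda>i. fact i * centred_fps z0 f $ i))"
proof -
  let ?Z = "disk_aut_fps z0" and ?G = "disk_aut_fps (f z0)" and ?A = "centred_fps z0 f"
  have z0': "cmod z0 < 1" using z0 by simp
  have "f analytic_on {z0}"
    using f z0 unfolding class_H_def by (auto simp: analytic_at intro!: exI[of _ "ball 0 1"])
  then have "(\<lambda>x. f (z0 + x)) has_fps_expansion fps_expansion f z0"
    by (rule analytic_at_imp_has_fps_expansion)
  from has_fps_expansion_compose[OF this has_fps_expansion_disk_aut[of z0] disk_aut_fps_nth_0]
  have L: "(\<lambda>u. f (disk_aut z0 u)) has_fps_expansion (fps_expansion f z0 oo ?Z)"
    by (simp add: comp_def)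
  from has_fps_expansion_compose[OF has_fps_expansion_disk_aut[of "f z0"]
      has_fps_expansion_centred_fps[OF f z0] centred_fps_nth_0]
  have "(\<lambda>u. disk_aut (f z0) (disk_aut (- f z0) (f (disk_aut z0 u))) - f z0) has_fps_expansion (?G oo ?A)"
    by (simp add: comp_def)
  from has_fps_expansion_add[OF this has_fps_expansion_const[of "f z0"]]
  have R: "(\<lambda>u. disk_aut (f z0) (disk_aut (- f z0) (f (disk_aut z0 u)))) has_fps_expansion
      ((?G oo ?A) + fps_const (f z0))"
    by simp
  have "\<forall>\<^sub>F u in nhds 0. f (disk_aut z0 u) = disk_aut (f z0) (disk_aut (- f z0) (f (disk_aut z0 u)))"
    using eventually_unit_ball
  proof (rule eventually_mono)
    fix u :: complex assume "u \<in> ball 0 1"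
    then have "cmod (f (disk_aut z0 u)) < 1"
      using class_H_norm[OF f] norm_disk_aut_less_1[OF z0'] by simp
    then show "f (disk_aut z0 u) = disk_aut (f z0) (disk_aut (- f z0) (f (disk_aut z0 u)))"
      using disk_aut_inverse[OF class_H_norm[OF f z0]] by simp
  qed
  from this R have "(\<lambda>u. f (disk_aut z0 u)) has_fps_expansion ((?G oo ?A) + fps_const (f z0))"
    by (rule has_fps_expansion_eventually)
  with L have eq: "fps_expansion f z0 oo ?Z = (?G oo ?A) + fps_const (f z0)"
    by (rule fps_expansion_unique_complex)
  \<comment> \<open>The \<open>k = 0\<close> term of the composition drops out, since
    \<open>Q ^ 0\<close> has coefficient 0 at every index \<open>n \<ge> 1\<close>.\<close>
  have split: "(P oo Q) $ n = (\<Sum>k=1..n. P $ k * (Q ^ k) $ n)" if "Q $ 0 = 0" for P Q :: "complex fps"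
    using \<open>1 \<le> n\<close> by (simp add: fps_compose_nth sum.atLeast_Suc_atMost)
  have "(\<Sum>k=1..n. hyp_alpha n k * cnj z0 ^ (n - k) * (1 - of_real ((cmod z0)\<^sup>2)) ^ k * (deriv ^^ k) f z0) =
      fact n * (fps_expansion f z0 oo ?Z) $ n"
    unfolding split[OF disk_aut_fps_nth_0] sum_distrib_left
  proof (intro sum.cong refl)
    fix k assume "k \<in> {1..n}"
    then show "hyp_alpha n k * cnj z0 ^ (n - k) * (1 - of_real ((cmod z0)\<^sup>2)) ^ k * (deriv ^^ k) f z0 =
        fact n * (fps_expansion f z0 $ k * (?Z ^ k) $ n)"
      by (simp add: disk_aut_fps_power_nth hyp_alpha_eq_binomial fps_expansion_def
          power_minus[of "cnj z0"])
  qed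
  also have "\<dots> = fact n * (?G oo ?A) $ n"
    unfolding eq using \<open>1 \<le> n\<close> by simp
  also have "\<dots> = (1 - of_real ((cmod (f z0))\<^sup>2)) *
      (\<Sum>k=1..n. fact k * (- cnj (f z0)) ^ (k - 1) * bell_poly n k (\<lambda>i. fact i * ?A $ i))"
    unfolding split[OF centred_fps_nth_0] sum_distrib_left
  proof (intro sum.cong refl)
    fix k assume k: "k \<in> {1..n}"
    have "fact n * (?G $ k * (?A ^ k) $ n) = ?G $ k * (fact n * (?A ^ k) $ n)" by simp
    then show "fact n * (?G $ k * (?A ^ k) $ n) = (1 - of_real ((cmod (f z0))\<^sup>2)) *
        (fact k * (- cnj (f z0)) ^ (k - 1) * bell_poly n k (\<lambda>i. fact i * ?A $ i))"
      using k by (simp add: fps_power_nth_eq_bell_poly disk_aut_fps_nth)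
  qed
  finally show ?thesis .
qed

section \<open>Taylor coefficients through the recursion for \<open>hyp_F\<close>\<close>

lemma hyp_F_0 [simp]: "hyp_F 0 \<gamma> = 0"
  by (simp add: hyp_F.simps)

lemma hyp_F_1 [simp]: "hyp_F (Suc 0) \<gamma> = \<gamma> 1"
  by (simp add: hyp_F.simps)

text \<open>For \<open>n = 2\<close> the sum is empty, so the separate second clause of the
  definition is an instance of the general recursion.\<close>

lemma hyp_F_rec:
  assumes "2 \<le> n"
  shows "hyp_F n \<gamma> = of_real (1 - (cmod (\<gamma> 1))\<^sup>2) * hyp_F (n - 1) (\<lambda>i. \<gamma> (i + 1))
    - cnj (\<gamma> 1) * (\<Sum>k=2..n-1. hyp_F (n - k) (\<lambda>i. \<gamma> (i + 1)) * hyp_F k \<gamma>)"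
proof (cases "n = 2")
  case True
  then show ?thesis by (simp add: hyp_F.simps[of 2]) (simp add: numeral_2_eq_2)
qed (use assms in \<open>simp add: hyp_F.simps[of n]\<close>)

lemma hyp_F_eq_0:
  assumes "\<And>i. 1 \<le> i \<Longrightarrow> \<gamma> i = 0"
  shows "hyp_F n \<gamma> = 0"
proof (induction n rule: less_induct)
  case (less n)
  consider "n = 0" | "n = 1" | "2 \<le> n" by linarith
  then show ?case
  proof cases
    case 3
    have "hyp_F (n - 1) (\<lambda>i. \<gamma> (i + 1)) = hyp_F (n - 1) \<gamma>"
      by (rule hyp_F_cong) (simp add: assms)
    then show ?thesis using 3 less by (simp add: hyp_F_rec assms)
  qed (simp_all add: assms)
qed

text \<open>By \<open>hyp_G_cong\<close> this exhibits affine dependence on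
  \<open>\<gamma> n\<close>: the first term will feed the centre of the disk of values, the slope
  its radius.\<close>

lemma hyp_F_eq_hyp_G:
  assumes "1 \<le> n"
  shows "hyp_F n \<gamma> = hyp_G n \<gamma> + of_real (\<Prod>k=1..n-1. 1 - (cmod (\<gamma> k))\<^sup>2) * \<gamma> n"
  using assms by (cases "n = 1") (auto simp: hyp_G_def)

text \<open>On the disk \<open>h\<close> is constant, so the numerator of the centred function is 0;
  the denominator is 0 as well, and division by 0 yields the desired value 0.\<close>

lemma centred_fps_unimodular:
  assumes z0: "z0 \<in> ball 0 1" and h: "h \<in> class_S" and c: "cmod (h z0) = 1"
  shows "centred_fps z0 h = 0"
  unfolding centred_fps_def
proof (rule fps_expansion_eqI)
  have ev: "\<forall>\<^sub>F u in nhds 0. disk_aut (- h z0) (h (disk_aut z0 u)) = 0"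
    using eventually_unit_ball
  proof (rule eventually_mono)
    fix u :: complex assume "u \<in> ball 0 1"
    then have "h (disk_aut z0 u) = h z0"
      using class_S_constant[OF h z0 c, of "disk_aut z0 u"] norm_disk_aut_less_1[of z0 u] z0 by simp
    then show "disk_aut (- h z0) (h (disk_aut z0 u)) = 0" by simp
  qed
  show "(\<lambda>u. disk_aut (- h z0) (h (disk_aut z0 u))) has_fps_expansion 0"
    by (rule has_fps_expansion_eventually[OF ev has_fps_expansion_0])
qed

text \<open>\<open>H\<close> is the series of \<open>q = h \<circ> disk_aut z0\<close>, and
  \<open>q\<close> is recovered from the centred version \<open>b\<close> of \<open>h\<close> as
  \<open>disk_aut (h z0) b\<close>. Clearing the denominator gives a product identity whose
  coefficients can be compared; it persists in the unimodular case, where \<open>b\<close> has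
  series 0 and \<open>H\<close> is constant.\<close>

lemma centred_fps_schur_step:
  assumes f: "f \<in> class_H" and z0: "z0 \<in> ball 0 1"
  defines "h \<equiv> hyp_quot z0 f"
  obtains H where "centred_fps z0 f = fps_X * H" "H $ 0 = h z0"
    "H * (1 + fps_const (cnj (h z0)) * centred_fps z0 h) = centred_fps z0 h + fps_const (h z0)"
proof -
  let ?B = "centred_fps z0 h"
  have h: "h \<in> class_S" unfolding h_def by (rule hyp_quot_in_class_S[OF f z0])
  have z0': "cmod z0 < 1" using z0 by simp
  obtain q where q: "q \<in> class_S"
    "\<And>u. u \<in> ball 0 1 \<Longrightarrow> disk_aut (- f z0) (f (disk_aut z0 u)) = u * q u"
    "\<And>z. z \<in> ball 0 1 \<Longrightarrow> h z = q (disk_aut (- z0) z)"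
    unfolding h_def using centred_quotient[OF f z0] by metis
  have hq: "h (disk_aut z0 u) = q u" if "u \<in> ball 0 1" for u
    using q(3)[of "disk_aut z0 u"] norm_disk_aut_less_1[OF z0'] disk_aut_inverse'[OF z0'] that
    by simp
  have q0: "q 0 = h z0" using hq[of 0] by simp
  define H where "H = fps_expansion q 0"
  have H: "q has_fps_expansion H"
    unfolding H_def using q(1) has_fps_expansion_fps_expansion[of "ball 0 1"]
    by (auto simp: class_S_def)
  have "(\<lambda>u. u * q u) has_fps_expansion fps_X * H"
    by (intro fps_expansion_intros H)
  moreover have "\<forall>\<^sub>F u in nhds 0. disk_aut (- f z0) (f (disk_aut z0 u)) = u * q u"
    using eventually_unit_ball by (rule eventually_mono) (rule q(2))
  ultimately have "(\<lambda>u. disk_aut (- f z0) (f (disk_aut z0 u))) has_fps_expansion fps_X * H"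
    by (rule has_fps_expansion_eventually[rotated])
  then have 1: "centred_fps z0 f = fps_X * H"
    unfolding centred_fps_def by (rule fps_expansion_eqI)
  have H0: "H $ 0 = h z0" by (simp add: H_def fps_expansion_def q0)
  have "H * (1 + fps_const (cnj (h z0)) * ?B) = ?B + fps_const (h z0)"
  proof (cases "cmod (h z0) = 1")
    case True
    have "H = fps_const (h z0)"
      unfolding H_def
    proof (rule fps_expansion_eqI)
      have "q u = h z0" if "u \<in> ball 0 1" for u
        using class_S_constant[OF q(1) _ _ that, of 0] q0 True by simp
      with eventually_unit_ball have "\<forall>\<^sub>F u in nhds 0. q u = h z0"
        by (rule eventually_mono)
      then show "q has_fps_expansion fps_const (h z0)"
        by (rule has_fps_expansion_eventually[OF _ has_fps_expansion_const])
    qed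
    then show ?thesis using centred_fps_unimodular[OF z0 h True] by simp
  next
    case False
    then have hz: "cmod (h z0) < 1" using class_S_norm[OF h z0] by simp
    then have hH: "h \<in> class_H" by (rule class_S_imp_class_H[OF h z0])
    define b where "b = (\<lambda>u. disk_aut (- h z0) (h (disk_aut z0 u)))"
    have b: "b has_fps_expansion ?B"
      unfolding b_def by (rule has_fps_expansion_centred_fps[OF hH z0])
    have L: "(\<lambda>u. q u * (1 + cnj (h z0) * b u)) has_fps_expansion
        H * (1 + fps_const (cnj (h z0)) * ?B)"
      by (intro fps_expansion_intros H b)
    have R: "(\<lambda>u. b u + h z0) has_fps_expansion ?B + fps_const (h z0)"
      by (intro fps_expansion_intros b)
    have "\<forall>\<^sub>F u in nhds 0. q u * (1 + cnj (h z0) * b u) = b u + h z0"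
      using eventually_unit_ball
    proof (rule eventually_mono)
      fix u :: complex assume u: "u \<in> ball 0 1"
      have w: "cmod (h (disk_aut z0 u)) < 1"
        using class_H_norm[OF hH] norm_disk_aut_less_1[OF z0'] u by simp
      have "cmod (b u) < 1"
        unfolding b_def using norm_disk_aut_less_1[of "- h z0", OF _ w] hz by simp
      then have "1 + cnj (h z0) * b u \<noteq> 0"
        using hz by (intro disk_aut_denominator_nonzero) auto
      moreover have "disk_aut (h z0) (b u) = q u"
        unfolding b_def using disk_aut_inverse[OF hz w] hq[OF u] by simp
      ultimately show "q u * (1 + cnj (h z0) * b u) = b u + h z0"
        by (simp add: disk_aut_def divide_eq_eq)
    qed
    then show ?thesis
      by (rule fps_expansion_unique_complex[OF L has_fps_expansion_eventually[OF _ R]])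
  qed
  with that 1 H0 show thesis by blast
qed

text \<open>The product identity of the Schur step, read at index \<open>n - 1\<close>, is the
  recursion for \<open>hyp_F\<close>. It involves lower coefficients of both \<open>f\<close> and
  its quotient, hence strong induction with \<open>f\<close> arbitrary.\<close>

lemma centred_fps_nth:
  assumes z0: "z0 \<in> ball 0 1" and "f \<in> class_S"
  shows "centred_fps z0 f $ n = hyp_F n (\<lambda>k. hyp_deriv k f z0)"
  using assms(2)
proof (induction n arbitrary: f rule: less_induct)
  case (less n)
  show ?case
  proof (cases "cmod (f z0) = 1")
    case True
    have "hyp_deriv i f z0 = 0" if "1 \<le> i" for i
      using class_S_unimodular[OF less.prems z0 True] that hyp_deriv_unimodular[of f "i - 1"] by simp
    then show ?thesis
      using centred_fps_unimodular[OF z0 less.prems True] by (simp add: hyp_F_eq_0)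
  next
    case False
    then have f: "f \<in> class_H"
      using class_S_imp_class_H[OF less.prems z0] class_S_norm[OF less.prems z0] by simp
    define h where "h = hyp_quot z0 f"
    have h: "h \<in> class_S" unfolding h_def by (rule hyp_quot_in_class_S[OF f z0])
    define A where "A = centred_fps z0 f"
    define B where "B = centred_fps z0 h"
    obtain H where H: "A = fps_X * H" "H $ 0 = h z0"
      "H * (1 + fps_const (cnj (h z0)) * B) = B + fps_const (h z0)"
      unfolding A_def B_def h_def using centred_fps_schur_step[OF f z0] by metis
    have AH: "A $ Suc k = H $ k" for k by (simp add: H(1))
    have A1: "A $ 1 = h z0" using H by simp
    have g1: "hyp_deriv (Suc 0) f z0 = h z0" by (simp add: hyp_deriv_Suc[OF f] h_def)
    consider "n = 0" | "n = 1" | "2 \<le> n" by linarith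
    then show ?thesis
    proof cases
      case 2
      then show ?thesis using A1 g1 by (simp add: A_def)
    next
      case 3
      have B: "hyp_F m (\<lambda>i. hyp_deriv (Suc i) f z0) = B $ m" if "m < n" for m
        using less.IH[OF that h] by (simp add: hyp_deriv_Suc[OF f] h_def B_def)
      have A: "hyp_F m (\<lambda>i. hyp_deriv i f z0) = A $ m" if "m < n" for m
        using less.IH[OF that less.prems] by (simp add: A_def)
      have "(H * B) $ (n - 1) = (\<Sum>k=0..n-1. A $ (k + 1) * B $ (n - 1 - k))"
        by (simp add: fps_mult_nth AH)
      also have "\<dots> = (\<Sum>k=1..n. A $ k * B $ (n - k))"
        using 3 by (intro sum.reindex_bij_witness[where i = "\<lambda>k. k - 1" and j = Suc]) auto
      \<comment> \<open>The \<open>k = 1\<close> term, with \<open>A $ 1 = h z0\<close>, will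
        combine with \<open>B $ (n - 1)\<close> into the factor \<open>1 - |h z0|^2\<close>. The
        \<open>k = n\<close> term then vanishes because \<open>B\<close> has no constant
        term.\<close>
      also have "\<dots> = A $ 1 * B $ (n - 1) + (\<Sum>k=2..n. A $ k * B $ (n - k))"
        using 3 by (subst sum.atLeast_Suc_atMost) (auto simp: numeral_2_eq_2)
      also have "(\<Sum>k=2..n. A $ k * B $ (n - k)) = (\<Sum>k=2..n-1. A $ k * B $ (n - k))"
        using 3 by (cases n) (auto simp: B_def)
      finally have HB: "(H * B) $ (n - 1) =
          h z0 * B $ (n - 1) + (\<Sum>k=2..n-1. A $ k * B $ (n - k))" using A1 by simp
      have "(H * (1 + fps_const (cnj (h z0)) * B)) $ (n - 1) =
          H $ (n - 1) + cnj (h z0) * (H * B) $ (n - 1)"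
        by (simp add: distrib_left mult.left_commute[of H])
      moreover have "(B + fps_const (h z0)) $ (n - 1) = B $ (n - 1)" using 3 by simp
      moreover have "A $ n = H $ (n - 1)" using H(1) 3 by simp
      ultimately have "A $ n = B $ (n - 1) - cnj (h z0) * (H * B) $ (n - 1)"
        using H(3) by (simp add: eq_diff_eq)
      also have "\<dots> = of_real (1 - (cmod (h z0))\<^sup>2) * B $ (n - 1) -
          cnj (h z0) * (\<Sum>k=2..n-1. B $ (n - k) * A $ k)"
      proof -
        have "of_real (1 - (cmod (h z0))\<^sup>2) = 1 - cnj (h z0) * h z0"
          by (simp only: of_real_diff complex_norm_square of_real_1 mult.commute)
        then show ?thesis unfolding HB by (simp add: algebra_simps)
      qed
      also have "(\<Sum>k=2..n-1. B $ (n - k) * A $ k) =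
          (\<Sum>k=2..n-1. hyp_F (n - k) (\<lambda>i. hyp_deriv (Suc i) f z0) * hyp_F k (\<lambda>i. hyp_deriv i f z0))"
        using 3 by (intro sum.cong refl arg_cong2[where f = times]) (auto simp: A B)
      finally show ?thesis
        unfolding A_def[symmetric] hyp_F_rec[OF 3] using 3 by (simp add: B g1)
    qed simp
  qed
qed

lemma hyp_s_eq:
  "hyp_s m z0 \<gamma> = (\<Sum>k=1..m. hyp_alpha (m + 1) k * cnj z0 ^ (m + 1 - k) * of_real ((1 - (cmod z0)\<^sup>2) ^ k)
                * (hyp_c k z0 \<gamma> + of_real (hyp_rho k z0 \<gamma>) * \<gamma> k)
                / of_real (1 - (cmod (\<gamma> 0))\<^sup>2))
           - (\<Sum>k=2..m+1. fact k * (- cnj (\<gamma> 0)) ^ (k - 1) * bell_poly (m + 1) k (hyp_d \<gamma>))"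
  by (cases "m = 0") (simp_all add: hyp_s.simps)

text \<open>The expansion identity is solved for its highest derivative. Strong induction is needed
  because \<open>hyp_s\<close> refers to the quantities \<open>p_k\<close> with
  \<open>k < n\<close>, which must first be recognised as lower derivatives of
  \<open>f\<close>.\<close>

theorem higher_deriv_eq_hyp_c_hyp_rho:
  assumes f: "f \<in> class_H" and z0: "z0 \<in> ball 0 1"
    and "1 \<le> n" and "\<And>k. k < n \<Longrightarrow> hyp_deriv k f z0 = \<gamma> k"
  shows "(deriv ^^ n) f z0 = hyp_c n z0 \<gamma> + of_real (hyp_rho n z0 \<gamma>) * hyp_deriv n f z0"
  using assms(3,4)
proof (induction n rule: less_induct)
  case (less n)
  \<comment> \<open>\<open>\<delta>\<close> is the full sequence of hyperbolic derivatives of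
    \<open>f\<close>; it is known to agree with \<open>\<gamma>\<close> only below index
    \<open>n\<close>.\<close>
  define \<delta> where "\<delta> k = hyp_deriv k f z0" for k
  define r where "r = 1 - (cmod z0)\<^sup>2"
  define D where "D = 1 - (cmod (\<gamma> 0))\<^sup>2"
  define A where "A = centred_fps z0 f"
  define p where "p k = (deriv ^^ k) f z0" for k
  have g0: "f z0 = \<gamma> 0" using less.prems(2)[of 0] less.prems(1) by simp
  have "0 < r" "0 < D"
    using z0 class_H_norm[OF f z0] by (simp_all add: r_def D_def g0 power_less_one_iff)
  have \<delta>: "\<delta> k = \<gamma> k" if "k < n" for k using less.prems(2)[OF that] by (simp add: \<delta>_def)
  have A: "A $ k = hyp_F k \<delta>" for k
    using centred_fps_nth[OF z0, of f k] f class_H_subset_class_S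
    by (auto simp: A_def \<delta>_def[abs_def])
  have p: "p k = hyp_c k z0 \<gamma> + of_real (hyp_rho k z0 \<gamma>) * \<gamma> k" if "1 \<le> k" "k < n" for k
    using less.IH[OF that(2,1)] less.prems(2) that by (simp add: p_def)
  \<comment> \<open>The two sides of the expansion identity without their top-order terms:
    \<open>S1\<close> omits \<open>k = n\<close>, which carries \<open>p n\<close>, and
    \<open>S2\<close> omits \<open>k = 1\<close>, which carries \<open>A $ n\<close>.\<close>
  define S1 where "S1 = (\<Sum>k=1..n-1. hyp_alpha n k * cnj z0 ^ (n - k) * of_real r ^ k * p k)"
  define S2 where "S2 = (\<Sum>k=2..n. fact k * (- cnj (\<gamma> 0)) ^ (k - 1) *
      bell_poly n k (\<lambda>i. fact i * A $ i))"
  have s: "hyp_s (n - 1) z0 \<gamma> = S1 / of_real D - S2"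
  proof -
    have "(\<Sum>k=2..n-1+1. fact k * (- cnj (\<gamma> 0)) ^ (k - 1) * bell_poly (n - 1 + 1) k (hyp_d \<gamma>)) = S2"
      unfolding S2_def
    proof (rule sum.cong)
      fix k assume k: "k \<in> {2..n}"
      \<comment> \<open>For \<open>k \<ge> 2\<close> the Bell polynomial reads arguments only up to
        \<open>n - k + 1 \<le> n - 1\<close>, where \<open>\<delta>\<close> and
        \<open>\<gamma>\<close> agree.\<close>
      have "bell_poly n k (hyp_d \<gamma>) = bell_poly n k (\<lambda>i. fact i * A $ i)"
      proof (rule bell_poly_cong)
        fix i assume "1 \<le> i" "i \<le> n - k + 1"
        then have "hyp_F i \<gamma> = hyp_F i \<delta>" using k by (intro hyp_F_cong) (auto simp: \<delta>)
        then show "hyp_d \<gamma> i = fact i * A $ i" by (simp add: hyp_d_def A)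
      qed
      then show "fact k * (- cnj (\<gamma> 0)) ^ (k - 1) * bell_poly (n - 1 + 1) k (hyp_d \<gamma>) =
          fact k * (- cnj (\<gamma> 0)) ^ (k - 1) * bell_poly n k (\<lambda>i. fact i * A $ i)"
        using less.prems(1) by simp
    qed (use less.prems(1) in simp)
    moreover have "(\<Sum>k=1..n-1. hyp_alpha (n - 1 + 1) k * cnj z0 ^ (n - 1 + 1 - k) * of_real (r ^ k)
        * (hyp_c k z0 \<gamma> + of_real (hyp_rho k z0 \<gamma>) * \<gamma> k) / of_real D) = S1 / of_real D"
      unfolding S1_def sum_divide_distrib using less.prems(1) by (intro sum.cong) (auto simp: p)
    ultimately show ?thesis unfolding hyp_s_eq r_def D_def by simp
  qed
  have "hyp_alpha n n = 1" by (simp add: hyp_alpha_def)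
  then have "(\<Sum>k=1..n. hyp_alpha n k * cnj z0 ^ (n - k) * of_real r ^ k * p k) = S1 + of_real r ^ n * p n"
    using less.prems(1) unfolding S1_def by (cases n) simp_all
  moreover have "(\<Sum>k=1..n. fact k * (- cnj (\<gamma> 0)) ^ (k - 1) * bell_poly n k (\<lambda>i. fact i * A $ i)) =
      fact n * A $ n + S2"
    using fps_power_nth_eq_bell_poly[of A 1 n] less.prems(1) unfolding S2_def
    by (subst sum.atLeast_Suc_atMost) (auto simp: numeral_2_eq_2 A_def)
  ultimately have "S1 + of_real r ^ n * p n = of_real D * (fact n * A $ n + S2)"
    using centred_expansion_identity[OF f z0 less.prems(1)]
    by (simp add: r_def D_def p_def A_def g0)
  then have "of_real r ^ n * p n = of_real D * (fact n * A $ n + S2) - S1"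
    by (simp add: eq_diff_eq add.commute)
  also have "\<dots> = of_real D * (fact n * A $ n + S2) - of_real D * (S1 / of_real D)"
    using \<open>0 < D\<close> by simp
  also have "\<dots> = of_real D * (fact n * A $ n - hyp_s (n - 1) z0 \<gamma>)"
    unfolding s by (simp only: algebra_simps)
  finally have "of_real r ^ n * p n = of_real D * (fact n * A $ n - hyp_s (n - 1) z0 \<gamma>)" .
  then have "p n = of_real (D / r ^ n) * (fact n * A $ n - hyp_s (n - 1) z0 \<gamma>)"
    using \<open>0 < r\<close> by (simp add: field_simps)
  also have "A $ n = hyp_G n \<gamma> + of_real (\<Prod>k=1..n-1. 1 - (cmod (\<gamma> k))\<^sup>2) * \<delta> n"
  proof -
    have "hyp_G n \<delta> = hyp_G n \<gamma>" by (rule hyp_G_cong) (simp add: \<delta>)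
    moreover have "(\<Prod>k=1..n-1. 1 - (cmod (\<delta> k))\<^sup>2) = (\<Prod>k=1..n-1. 1 - (cmod (\<gamma> k))\<^sup>2)"
      using less.prems(1) by (intro prod.cong) (auto simp: \<delta>)
    ultimately show ?thesis using hyp_F_eq_hyp_G[OF less.prems(1), of \<delta>] A by simp
  qed
  finally have "p n = of_real (D / r ^ n) * (fact n * hyp_G n \<gamma> - hyp_s (n - 1) z0 \<gamma>) +
      of_real (D / r ^ n * fact n * (\<Prod>k=1..n-1. 1 - (cmod (\<gamma> k))\<^sup>2)) * \<delta> n"
    by (simp add: algebra_simps diff_divide_distrib add_divide_distrib)
  moreover have "hyp_rho n z0 \<gamma> = D / r ^ n * fact n * (\<Prod>k=1..n-1. 1 - (cmod (\<gamma> k))\<^sup>2)"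
  proof -
    obtain m where m: "n = Suc m" using less.prems(1) by (cases n) auto
    have "(\<Prod>k<n. 1 - (cmod (\<gamma> k))\<^sup>2) = D * (\<Prod>k<m. 1 - (cmod (\<gamma> (Suc k)))\<^sup>2)"
      unfolding m D_def by (rule prod.lessThan_Suc_shift)
    also have "(\<Prod>k<m. 1 - (cmod (\<gamma> (Suc k)))\<^sup>2) = (\<Prod>k=1..n-1. 1 - (cmod (\<gamma> k))\<^sup>2)"
      unfolding m by (rule prod.reindex_bij_witness[where i = "\<lambda>k. k - 1" and j = Suc]) auto
    finally show ?thesis by (simp add: hyp_rho_def r_def)
  qed
  moreover have "hyp_c n z0 \<gamma> = of_real (D / r ^ n) * (fact n * hyp_G n \<gamma> - hyp_s (n - 1) z0 \<gamma>)"
    using less.prems(1) by (simp add: hyp_c.simps D_def r_def)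
  ultimately show ?case by (simp add: p_def \<delta>_def)
qed

subsection \<open>Blaschke products\<close>

text \<open>A list of zeros with multiplicity and a unimodular constant, instead of indexed zeros
  and an angle, suit induction over nested automorphisms.\<close>

lemma blaschke_productI:
  assumes "cmod c = 1" "length as = m" "\<forall>x\<in>set as. cmod x < 1"
    "\<And>z. z \<in> ball 0 1 \<Longrightarrow> f z = c * (\<Prod>x\<leftarrow>as. hbracket z x)"
  shows "blaschke_product m f"
  unfolding blaschke_product_def
proof (intro exI[of _ "Arg c"] exI[of _ "\<lambda>i. as ! (i - 1)"] conjI ballI)
  fix i assume "i \<in> {1..m}"
  then have "as ! (i - 1) \<in> set as" using assms(2) by (intro nth_mem) auto
  then show "as ! (i - 1) \<in> ball 0 1" using assms(3) by simp
next
  fix z :: complex assume z: "z \<in> ball 0 1"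
  have "(\<Prod>x\<leftarrow>as. hbracket z x) = (\<Prod>i=0..<m. hbracket z (as ! i))"
    using assms(2) by (subst prod.list_conv_set_nth) simp
  also have "\<dots> = (\<Prod>i=1..m. hbracket z (as ! (i - 1)))"
    by (rule prod.reindex_bij_witness[where i = "\<lambda>i. i - 1" and j = Suc]) auto
  moreover have "cis (Arg c) = c" using assms(1) by (subst cis_Arg) (auto simp: sgn_eq)
  ultimately show "f z = cis (Arg c) * (\<Prod>i=1..m. hbracket z (as ! (i - 1)))"
    using assms(4)[OF z] by simp
qed

section \<open>Numerator and denominator polynomials of a Blaschke product\<close>

definition root_poly :: "complex list \<Rightarrow> complex poly" where
  "root_poly as = (\<Prod>x\<leftarrow>as. [:- x, 1:])"

text \<open>The conjugate reciprocal of \<open>root_poly as\<close>, that is, its reflection in the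
  unit circle multiplied by \<open>z ^ length as\<close>.\<close>

definition reflected_root_poly :: "complex list \<Rightarrow> complex poly" where
  "reflected_root_poly as = (\<Prod>x\<leftarrow>as. [:1, - cnj x:])"

lemma poly_root_poly_Cons:
  "poly (root_poly []) z = 1" "poly (root_poly (x # as)) z = (z - x) * poly (root_poly as) z"
  by (simp_all add: root_poly_def algebra_simps)

lemma poly_reflected_root_poly_Cons:
  "poly (reflected_root_poly []) z = 1"
  "poly (reflected_root_poly (x # as)) z = (1 - cnj x * z) * poly (reflected_root_poly as) z"
  by (simp_all add: reflected_root_poly_def algebra_simps)

lemma prod_hbracket_eq:
  "(\<Prod>x\<leftarrow>as. hbracket z x) = poly (root_poly as) z / poly (reflected_root_poly as) z"
  by (induction as) (simp_all add: poly_root_poly_Cons poly_reflected_root_poly_Cons hbracket_def)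

lemma degree_root_poly: "degree (root_poly as) = length as" "coeff (root_poly as) (length as) = 1"
proof -
  have "degree (root_poly as) = length as \<and> lead_coeff (root_poly as) = 1"
  proof (induction as)
    case (Cons x as)
    then have "root_poly as \<noteq> 0" by auto
    then have "degree ([:- x, 1:] * root_poly as) = Suc (length as)"
      using Cons by (subst degree_mult_eq) auto
    moreover have "lead_coeff ([:- x, 1:] * root_poly as) = 1"
      using Cons by (subst lead_coeff_mult) auto
    moreover have "root_poly (x # as) = [:- x, 1:] * root_poly as" by (simp add: root_poly_def)
    ultimately show ?case by simp
  qed (simp add: root_poly_def)
  then show "degree (root_poly as) = length as" "coeff (root_poly as) (length as) = 1" by auto
qed

lemma degree_reflected_root_poly: "degree (reflected_root_poly as) \<le> length as"
proof (induction as)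
  case (Cons x as)
  have "degree (reflected_root_poly (x # as)) \<le> degree [:1, - cnj x:] + degree (reflected_root_poly as)"
    unfolding reflected_root_poly_def list.map prod_list.Cons by (rule degree_mult_le)
  also have "\<dots> \<le> 1 + length as" using Cons by (intro add_mono) auto
  finally show ?case by simp
qed (simp add: reflected_root_poly_def)

text \<open>This coefficient is the product of the \<open>- cnj x\<close>. It may be 0, so it is
  addressed by the index \<open>length as\<close> and not as a leading coefficient.\<close>

lemma norm_coeff_reflected_root_poly:
  assumes "\<forall>x\<in>set as. cmod x < 1"
  shows "cmod (coeff (reflected_root_poly as) (length as)) \<le> 1"
  using assms
proof (induction as)
  case (Cons x as)
  have "coeff (reflected_root_poly as) (Suc (length as)) = 0"
    by (rule coeff_eq_0) (use degree_reflected_root_poly[of as] in simp)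
  then have "coeff (reflected_root_poly (x # as)) (length (x # as)) =
      - cnj x * coeff (reflected_root_poly as) (length as)"
    by (simp add: reflected_root_poly_def)
  also have "cmod \<dots> \<le> 1"
    using Cons by (auto simp: norm_mult intro!: mult_le_one)
  finally show ?case .
qed (simp add: reflected_root_poly_def)

text \<open>A Blaschke factor has modulus at least 1 outside the open disk; the form without
  division also makes sense at its pole.\<close>

lemma norm_reflected_factor_le:
  assumes "1 \<le> cmod z" "cmod x < 1"
  shows "cmod (1 - cnj x * z) \<le> cmod (z - x)"
proof -
  have "(cmod (z - x))\<^sup>2 - (cmod (1 - cnj x * z))\<^sup>2 = ((cmod z)\<^sup>2 - 1) * (1 - (cmod x)\<^sup>2)"
    unfolding cmod_power2 by (simp add: algebra_simps power2_eq_square)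
  moreover have "\<dots> \<ge> 0"
    using assms by (intro mult_nonneg_nonneg) (auto simp: power_le_one_iff)
  ultimately have "(cmod (1 - cnj x * z))\<^sup>2 \<le> (cmod (z - x))\<^sup>2" by linarith
  then show ?thesis by (rule power2_le_imp_le) simp
qed

lemma norm_reflected_root_poly_le:
  assumes "1 \<le> cmod z" "\<forall>x\<in>set as. cmod x < 1"
  shows "cmod (poly (reflected_root_poly as) z) \<le> cmod (poly (root_poly as) z)"
  using assms(2)
  by (induction as) (auto simp: poly_root_poly_Cons poly_reflected_root_poly_Cons norm_mult
      intro!: mult_mono norm_reflected_factor_le[OF assms(1)])

lemma poly_root_poly_eq_0_iff: "poly (root_poly as) z = 0 \<longleftrightarrow> z \<in> set as"
  by (induction as) (auto simp: poly_root_poly_Cons)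

lemma poly_reflected_root_poly_nonzero:
  assumes "cmod z < 1" "\<forall>x\<in>set as. cmod x < 1"
  shows "poly (reflected_root_poly as) z \<noteq> 0"
  using assms(2)
proof (induction as)
  case (Cons x as)
  have "1 - cnj x * z \<noteq> 0"
    using disk_aut_denominator_nonzero[of "- x" z] Cons.prems assms(1) by simp
  then show ?case using Cons by (simp add: poly_reflected_root_poly_Cons)
qed (simp add: poly_reflected_root_poly_Cons)

lemma reflect_root_poly:
  assumes "z \<noteq> 0"
  shows "z ^ length as * cnj (poly (root_poly as) (inverse (cnj z))) = poly (reflected_root_poly as) z"
    and "z ^ length as * cnj (poly (reflected_root_poly as) (inverse (cnj z))) = poly (root_poly as) z"
proof -
  have *: "z * (inverse z - cnj x) = 1 - cnj x * z" "z * (1 - x * inverse z) = z - x" for x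
    using assms by (simp_all add: algebra_simps)
  show "z ^ length as * cnj (poly (root_poly as) (inverse (cnj z))) = poly (reflected_root_poly as) z"
  proof (induction as)
    case (Cons x as)
    have "z ^ length (x # as) * cnj (poly (root_poly (x # as)) (inverse (cnj z))) =
        (z * (inverse z - cnj x)) * (z ^ length as * cnj (poly (root_poly as) (inverse (cnj z))))"
      by (simp add: poly_root_poly_Cons)
    then show ?case unfolding Cons * poly_reflected_root_poly_Cons .
  qed (simp add: poly_root_poly_Cons poly_reflected_root_poly_Cons)
  show "z ^ length as * cnj (poly (reflected_root_poly as) (inverse (cnj z))) = poly (root_poly as) z"
  proof (induction as)
    case (Cons x as)
    have "z ^ length (x # as) * cnj (poly (reflected_root_poly (x # as)) (inverse (cnj z))) =
        (z * (1 - x * inverse z)) * (z ^ length as * cnj (poly (reflected_root_poly as) (inverse (cnj z))))"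
      by (simp add: poly_reflected_root_poly_Cons)
    then show ?case unfolding Cons * poly_root_poly_Cons .
  qed (simp add: poly_root_poly_Cons poly_reflected_root_poly_Cons)
qed

text \<open>Writing the product as \<open>P / Q\<close>, the left side becomes \<open>N / D\<close>.
  The degree of \<open>N\<close> is unchanged, its zeros lie in the disk since
  \<open>|Q| \<le> |P|\<close> outside, and \<open>D\<close> is the reflection of \<open>N\<close>
  up to a constant. The roots of \<open>N\<close> are therefore the new zeros.\<close>

lemma disk_aut_blaschke:
  assumes a: "cmod a < 1" and c: "cmod c = 1" and as: "\<forall>x\<in>set as. cmod x < 1"
  obtains d bs where "cmod d = 1" "length bs = length as" "\<forall>x\<in>set bs. cmod x < 1"
    "\<And>z. cmod z < 1 \<Longrightarrow>
      disk_aut a (c * (\<Prod>x\<leftarrow>as. hbracket z x)) = d * (\<Prod>x\<leftarrow>bs. hbracket z x)"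
proof -
  define P where "P = root_poly as"
  define Q where "Q = reflected_root_poly as"
  define N where "N = smult c P + smult a Q"
  define D where "D = Q + smult (cnj a * c) P"
  have cc: "c * cnj c = 1" using c complex_norm_square[of c] by simp
  \<comment> \<open>No cancellation at the top: \<open>|c| = 1\<close> dominates the second summand,
    whose modulus is below 1.\<close>
  have "coeff N (length as) = c + a * coeff Q (length as)"
    by (simp add: N_def P_def degree_root_poly(2))
  moreover have "cmod (a * coeff Q (length as)) < 1"
  proof -
    have "cmod a * cmod (coeff Q (length as)) \<le> cmod a * 1"
      unfolding Q_def by (intro mult_left_mono norm_coeff_reflected_root_poly as) simp
    then show ?thesis using a by (simp add: norm_mult)
  qed
  ultimately have "coeff N (length as) \<noteq> 0"
    using c by (metis add_eq_0_iff norm_minus_cancel less_irrefl)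
  moreover have "degree N \<le> length as"
    unfolding N_def P_def Q_def using degree_root_poly(1)[of as] degree_reflected_root_poly[of as]
    by (intro degree_add_le) (auto intro: order_trans[OF degree_smult_le])
  ultimately have degN: "degree N = length as" and "N \<noteq> 0"
    by (auto simp: le_degree antisym)
  obtain A where A: "size A = degree N" "N = smult (lead_coeff N) (\<Prod>x\<in>#A. [:- x, 1:])"
    using alg_closed_imp_factorization[OF \<open>N \<noteq> 0\<close>] by blast
  obtain bs where bs: "A = mset bs" by (metis ex_mset)
  define l where "l = lead_coeff N"
  have "l \<noteq> 0" using \<open>N \<noteq> 0\<close> by (simp add: l_def)
  have len: "length bs = length as" using A(1) degN by (simp add: bs)
  have N: "N = smult l (root_poly bs)"
    using A(2) by (simp add: bs l_def root_poly_def prod_mset_prod_list flip: mset_map)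
  have roots: "cmod b < 1" if "b \<in> set bs" for b
  proof (rule ccontr)
    assume "\<not> cmod b < 1"
    then have b: "1 \<le> cmod b" by simp
    have "poly N b = 0" using that poly_root_poly_eq_0_iff[of bs b] by (simp add: N)
    \<comment> \<open>At a root outside the disk, \<open>|P| = |a| |Q| \<le> |a| |P|\<close> with
      \<open>|a| < 1\<close> forces \<open>P\<close> to vanish, but all roots of \<open>P\<close>
      are inside.\<close>
    then have "c * poly P b = - (a * poly Q b)" by (simp add: N_def eq_neg_iff_add_eq_0)
    then have "cmod (poly P b) = cmod a * cmod (poly Q b)"
      using c by (metis norm_minus_cancel norm_mult mult_1)
    also have "\<dots> \<le> cmod a * cmod (poly P b)"
      unfolding P_def Q_def by (intro mult_left_mono norm_reflected_root_poly_le b as) simp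
    finally have "(1 - cmod a) * cmod (poly P b) \<le> 0" by (simp add: algebra_simps)
    then have "cmod (poly P b) \<le> 0" using a by (simp add: mult_le_0_iff)
    then have "b \<in> set as" by (simp add: P_def poly_root_poly_eq_0_iff)
    then show False using as b by auto
  qed
  have refl: "cnj c * poly D z = cnj l * poly (reflected_root_poly bs) z" if "z \<noteq> 0" for z
  proof -
    have "cnj c * poly D z = cnj c * poly Q z + (c * cnj c) * cnj a * poly P z"
      by (simp add: D_def algebra_simps)
    also have "\<dots> = cnj c * poly Q z + cnj a * poly P z" by (simp add: cc)
    also have "\<dots> = z ^ length as * cnj (poly N (inverse (cnj z)))"
      unfolding P_def Q_def reflect_root_poly[OF that, of as, symmetric]
      by (simp add: N_def P_def Q_def algebra_simps)
    also have "\<dots> = cnj l * (z ^ length bs * cnj (poly (root_poly bs) (inverse (cnj z))))"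
      by (simp add: N len)
    finally show ?thesis by (simp add: reflect_root_poly[OF that])
  qed
  \<comment> \<open>Reflection excludes the origin; the factor \<open>[:0, 1:]\<close> makes the
    polynomial vanish there too, and is cancelled afterwards.\<close>
  have "[:0, 1:] * (smult (cnj c) D - smult (cnj l) (reflected_root_poly bs)) = 0"
    using refl by (intro poly_all_0_iff_0[THEN iffD1]) auto
  then have "smult (cnj c) D = smult (cnj l) (reflected_root_poly bs)"
    by simp
  then have "cnj c * poly D z = cnj l * poly (reflected_root_poly bs) z" for z
    by (metis poly_smult)
  then have "c * (cnj c * poly D z) = c * (cnj l * poly (reflected_root_poly bs) z)" for z by simp
  then have D: "poly D z = c * cnj l * poly (reflected_root_poly bs) z" for z
    by (metis cc mult.assoc mult_1)
  show thesis
  proof (rule that[of "l / (c * cnj l)" bs])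
    show "cmod (l / (c * cnj l)) = 1" using \<open>l \<noteq> 0\<close> c by (simp add: norm_divide norm_mult)
    fix z :: complex assume z: "cmod z < 1"
    have Q: "poly Q z \<noteq> 0" unfolding Q_def by (rule poly_reflected_root_poly_nonzero[OF z as])
    have "disk_aut a (c * (\<Prod>x\<leftarrow>as. hbracket z x)) =
        (c * (poly P z / poly Q z) + a) / (1 + cnj a * (c * (poly P z / poly Q z)))"
      by (simp add: disk_aut_def prod_hbracket_eq P_def Q_def)
    also have "c * (poly P z / poly Q z) + a = poly N z / poly Q z"
      using Q by (simp add: N_def field_simps)
    also have "1 + cnj a * (c * (poly P z / poly Q z)) = poly D z / poly Q z"
      using Q by (simp add: D_def field_simps)
    also have "(poly N z / poly Q z) / (poly D z / poly Q z) = poly N z / poly D z"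
      using Q by simp
    also have "\<dots> = l / (c * cnj l) * (\<Prod>x\<leftarrow>bs. hbracket z x)"
      by (simp add: N D prod_hbracket_eq)
    finally show "disk_aut a (c * (\<Prod>x\<leftarrow>as. hbracket z x)) =
        l / (c * cnj l) * (\<Prod>x\<leftarrow>bs. hbracket z x)" .
  qed (use len roots in auto)
qed

text \<open>The factor \<open>disk_aut (- z0) z\<close> is \<open>hbracket z z0\<close>, so each
  level adds the zero \<open>z0\<close>, and the automorphism around it preserves the number of
  zeros.\<close>

lemma nested_aut_blaschke:
  assumes z0: "z0 \<in> ball 0 1" and c: "cmod c = 1" and "\<forall>g\<in>set gs. cmod g < 1"
  shows "\<exists>d bs. cmod d = 1 \<and> length bs = length gs \<and> (\<forall>x\<in>set bs. cmod x < 1) \<and>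
    (\<forall>z\<in>ball 0 1. nested_aut z0 gs c z = d * (\<Prod>x\<leftarrow>bs. hbracket z x))"
  using assms(3)
proof (induction gs)
  case Nil
  then show ?case using c by (auto intro!: exI[of _ c] exI[of _ "[]"])
next
  case (Cons g gs)
  obtain d bs where d: "cmod d = 1" "length bs = length gs" "\<forall>x\<in>set bs. cmod x < 1"
    "\<forall>z\<in>ball 0 1. nested_aut z0 gs c z = d * (\<Prod>x\<leftarrow>bs. hbracket z x)"
    using Cons by auto
  have "\<forall>x\<in>set (z0 # bs). cmod x < 1" using d(3) z0 by simp
  from disk_aut_blaschke[OF _ d(1) this, of g] obtain e cs where e: "cmod e = 1"
    "length cs = length (z0 # bs)" "\<forall>x\<in>set cs. cmod x < 1"
    "\<And>z. cmod z < 1 \<Longrightarrow> disk_aut g (d * (\<Prod>x\<leftarrow>z0 # bs. hbracket z x)) = e * (\<Prod>x\<leftarrow>cs. hbracket z x)"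
    using Cons.prems by auto
  have "nested_aut z0 (g # gs) c z = e * (\<Prod>x\<leftarrow>cs. hbracket z x)" if "z \<in> ball 0 1" for z
    using e(4)[of z] d(4) that by (simp add: hbracket_eq_disk_aut mult.left_commute)
  then show ?case using e(1-3) d(2) by auto
qed

subsection \<open>The region of values\<close>

lemma const_in_class_S: "\<epsilon> \<in> cball 0 1 \<Longrightarrow> (\<lambda>_. \<epsilon>) \<in> class_S"
  by (auto simp: class_S_def)

text \<open>Even for \<open>|\<epsilon>| = 1\<close> the function stays in \<open>class_H\<close>:
  as \<open>n \<ge> 1\<close>, its value at \<open>z0\<close> is \<open>\<gamma> 0\<close>, of
  modulus less than 1.\<close>

lemma extremal_props:
  assumes z0: "z0 \<in> ball 0 1" and "1 \<le> n" and \<gamma>: "\<And>k. k < n \<Longrightarrow> cmod (\<gamma> k) < 1"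
    and \<epsilon>: "\<epsilon> \<in> cball 0 1"
  shows "extremal n z0 \<gamma> \<epsilon> \<in> hyp_data_class n z0 \<gamma>"
    and "hyp_deriv n (extremal n z0 \<gamma> \<epsilon>) z0 = \<epsilon>"
proof -
  have e: "extremal n z0 \<gamma> \<epsilon> = (\<lambda>z. nested_aut z0 (map \<gamma> [0..<n]) ((\<lambda>_. \<epsilon>) z) z)"
    by (simp add: extremal_def fun_eq_iff)
  have gs: "\<forall>g\<in>set (map \<gamma> [0..<n]). cmod g < 1" using \<gamma> by auto
  note S = const_in_class_S[OF \<epsilon>]
  have d: "hyp_deriv k (extremal n z0 \<gamma> \<epsilon>) z0 = (map \<gamma> [0..<n] @ [\<epsilon>]) ! k" if "k \<le> n" for k
    unfolding e using hyp_deriv_nested_aut[OF z0 S gs] that by simp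
  then show "hyp_deriv n (extremal n z0 \<gamma> \<epsilon>) z0 = \<epsilon>" by (simp add: nth_append)
  have k: "hyp_deriv k (extremal n z0 \<gamma> \<epsilon>) z0 = \<gamma> k" if "k < n" for k
    using d[of k] that by (simp add: nth_append)
  have 0: "extremal n z0 \<gamma> \<epsilon> z0 = \<gamma> 0" using k[of 0] assms(2) by simp
  have "extremal n z0 \<gamma> \<epsilon> \<in> class_S"
    unfolding e by (rule nested_aut_in_class_S[OF z0 S gs])
  then have "extremal n z0 \<gamma> \<epsilon> \<in> class_H"
    using class_S_imp_class_H[OF _ z0] 0 \<gamma>[of 0] assms(2) by simp
  then show "extremal n z0 \<gamma> \<epsilon> \<in> hyp_data_class n z0 \<gamma>"
    using k 0 by (auto simp: hyp_data_class_def)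
qed

lemma hyp_data_class_hyp_deriv:
  assumes "g \<in> hyp_data_class n z0 \<gamma>" "k < n"
  shows "hyp_deriv k g z0 = \<gamma> k"
  using assms by (cases "k = 0") (auto simp: hyp_data_class_def)

theorem theorem2p7:
  fixes n :: nat and z0 :: complex and \<gamma> :: "nat \<Rightarrow> complex" and f :: "complex \<Rightarrow> complex"
  assumes "1 \<le> n"
    and "z0 \<in> ball 0 1"
    and "\<forall>i<n. \<gamma> i \<in> cball 0 1"
    and "f \<in> hyp_data_class n z0 \<gamma>"
  shows "0 \<le> hyp_rho n z0 \<gamma>
    \<and> (\<forall>j\<in>{1..n-1}.
         (\<forall>i\<in>{1..j-1}. cmod (\<gamma> i) < 1) \<and> cmod (\<gamma> j) = 1 \<and> (\<forall>i\<in>{j+1..n-1}. \<gamma> i = 0) \<longrightarrow>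
           (deriv ^^ n) f z0 = hyp_c n z0 \<gamma>
         \<and> (\<forall>z\<in>ball 0 1. f z = nested_aut z0 (map \<gamma> [0..<j]) (\<gamma> j) z)
         \<and> blaschke_product j f)
    \<and> ((\<forall>i\<in>{1..n-1}. cmod (\<gamma> i) < 1) \<longrightarrow>
           {(deriv ^^ n) g z0 | g. g \<in> hyp_data_class n z0 \<gamma>} = cball (hyp_c n z0 \<gamma>) (hyp_rho n z0 \<gamma>)
         \<and> cball (hyp_c n z0 \<gamma>) (hyp_rho n z0 \<gamma>)
             = {(deriv ^^ n) (extremal n z0 \<gamma> \<epsilon>) z0 | \<epsilon>. \<epsilon> \<in> cball 0 1}
         \<and> (\<exists>h\<in>class_S. \<forall>z\<in>ball 0 1. f z = nested_aut z0 (map \<gamma> [0..<n]) (h z) z)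
         \<and> ((deriv ^^ n) f z0 \<in> sphere (hyp_c n z0 \<gamma>) (hyp_rho n z0 \<gamma>) \<longleftrightarrow>
             (\<exists>\<epsilon>\<in>sphere 0 1. \<forall>z\<in>ball 0 1. f z = extremal n z0 \<gamma> \<epsilon> z)))"
    (is "?nonneg \<and> ?part1 \<and> (?lt \<longrightarrow> ?region \<and> ?extremal \<and> ?form \<and> ?boundary)")
proof (intro conjI)
  note z0 = assms(2)
  define c where "c = hyp_c n z0 \<gamma>"
  define \<rho> where "\<rho> = hyp_rho n z0 \<gamma>"
  have class_H: "g \<in> class_H" if "g \<in> hyp_data_class n z0 \<gamma>" for g
    using that by (simp add: hyp_data_class_def)
  have deriv_eq: "(deriv ^^ n) g z0 = c + of_real \<rho> * hyp_deriv n g z0"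
    if "g \<in> hyp_data_class n z0 \<gamma>" for g
    unfolding c_def \<rho>_def
    using higher_deriv_eq_hyp_c_hyp_rho[OF class_H[OF that] z0 assms(1)]
      hyp_data_class_hyp_deriv[OF that] by blast
  have fH: "f \<in> class_H" and fS: "f \<in> class_S"
    using class_H[OF assms(4)] class_H_subset_class_S by auto
  note f\<gamma> = hyp_data_class_hyp_deriv[OF assms(4)]
  \<comment> \<open>The strict bound comes from \<open>f\<close> itself, since
    \<open>\<gamma> 0\<close> is one of its values.\<close>
  have \<gamma>0: "cmod (\<gamma> 0) < 1"
    using class_H_norm[OF fH z0] f\<gamma>[of 0] assms(1) by simp
  have r: "0 < 1 - (cmod z0)\<^sup>2" using z0 by (simp add: power_less_one_iff)
  show ?nonneg
    unfolding hyp_rho_def using assms(3) r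
    by (auto intro!: divide_nonneg_pos mult_nonneg_nonneg prod_nonneg simp: power_le_one)
  show ?part1
  proof (intro ballI impI)
    fix j assume j: "j \<in> {1..n-1}"
      and asm: "(\<forall>i\<in>{1..j-1}. cmod (\<gamma> i) < 1) \<and> cmod (\<gamma> j) = 1 \<and> (\<forall>i\<in>{j+1..n-1}. \<gamma> i = 0)"
    have jn: "j < n" using j assms(1) by auto
    have lt: "cmod (\<gamma> k) < 1" if "k < j" for k
      using \<gamma>0 asm that by (cases "k = 0") auto
    have fj: "hyp_deriv k f z0 = \<gamma> k" if "k < j" for k
      using f\<gamma> that jn by simp
    obtain h where h: "h \<in> class_S" "h z0 = hyp_deriv j f z0"
      "\<And>z. z \<in> ball 0 1 \<Longrightarrow> f z = nested_aut z0 (map \<gamma> [0..<j]) (h z) z"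
      by (rule nested_aut_representation[OF z0 fS, of j \<gamma>]) (blast intro: fj lt)+
    have hz0: "h z0 = \<gamma> j" using h(2) f\<gamma>[OF jn] by simp
    have hc: "h z = \<gamma> j" if "z \<in> ball 0 1" for z
      using class_S_constant[OF h(1) z0 _ that] hz0 asm by simp
    have rep: "\<forall>z\<in>ball 0 1. f z = nested_aut z0 (map \<gamma> [0..<j]) (\<gamma> j) z"
      using h(3) hc by simp
    \<comment> \<open>As \<open>j < n\<close>, the product in \<open>hyp_rho\<close> contains the
      vanishing factor \<open>1 - |\<gamma>_j|^2\<close>, so only the centre survives in
      \<open>deriv_eq\<close>.\<close>
    have "\<rho> = 0"
      unfolding \<rho>_def hyp_rho_def using asm jn by (auto intro!: bexI[of _ j])
    then have "(deriv ^^ n) f z0 = hyp_c n z0 \<gamma>"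
      using deriv_eq[OF assms(4)] by (simp add: c_def)
    moreover have "blaschke_product j f"
    proof -
      have "\<forall>g\<in>set (map \<gamma> [0..<j]). cmod g < 1" using lt by auto
      from nested_aut_blaschke[OF z0 _ this, of "\<gamma> j"] asm
      obtain d bs where "cmod d = 1" "length bs = j" "\<forall>x\<in>set bs. cmod x < 1"
        "\<forall>z\<in>ball 0 1. nested_aut z0 (map \<gamma> [0..<j]) (\<gamma> j) z = d * (\<Prod>x\<leftarrow>bs. hbracket z x)"
        by auto
      then show ?thesis using rep by (intro blaschke_productI) auto
    qed
    ultimately show "(deriv ^^ n) f z0 = hyp_c n z0 \<gamma>
         \<and> (\<forall>z\<in>ball 0 1. f z = nested_aut z0 (map \<gamma> [0..<j]) (\<gamma> j) z)
         \<and> blaschke_product j f"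
      using rep by blast
  qed
  show "?lt \<longrightarrow> ?region \<and> ?extremal \<and> ?form \<and> ?boundary"
  proof
    assume ?lt
    then have lt: "cmod (\<gamma> k) < 1" if "k < n" for k
      using \<gamma>0 that by (cases "k = 0") auto
    have "0 < \<rho>"
      unfolding \<rho>_def hyp_rho_def using lt r
      by (auto intro!: divide_pos_pos mult_pos_pos prod_pos simp: power_less_one_iff)
    have ex: "extremal n z0 \<gamma> \<epsilon> \<in> hyp_data_class n z0 \<gamma>"
      "hyp_deriv n (extremal n z0 \<gamma> \<epsilon>) z0 = \<epsilon>" if "\<epsilon> \<in> cball 0 1" for \<epsilon>
      using extremal_props[OF z0 assms(1) _ that, of \<gamma>] lt by auto
    \<comment> \<open>The inclusions \<open>sub1\<close>, \<open>sub2\<close>, \<open>sub3\<close>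
      form a cycle through all values, the disk and the extremal values, which makes the three sets
      equal.\<close>
    have sub1: "{(deriv ^^ n) g z0 | g. g \<in> hyp_data_class n z0 \<gamma>} \<subseteq> cball c \<rho>"
    proof safe
      fix g assume g: "g \<in> hyp_data_class n z0 \<gamma>"
      then have "cmod (hyp_deriv n g z0) \<le> 1"
        using norm_hyp_deriv_le_1[OF z0] class_H class_H_subset_class_S by blast
      then show "(deriv ^^ n) g z0 \<in> cball c \<rho>"
        using deriv_eq[OF g] \<open>0 < \<rho>\<close> by (simp add: dist_norm norm_mult mult_left_le)
    qed
    have sub2: "cball c \<rho> \<subseteq> {(deriv ^^ n) (extremal n z0 \<gamma> \<epsilon>) z0 | \<epsilon>. \<epsilon> \<in> cball 0 1}"
    proof
      fix w assume w: "w \<in> cball c \<rho>"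
      \<comment> \<open>The preimage of \<open>w\<close> under the affine map
        \<open>\<epsilon> \<mapsto> c + \<rho> * \<epsilon>\<close> given by
        \<open>deriv_eq\<close>.\<close>
      define \<epsilon> where "\<epsilon> = (w - c) / of_real \<rho>"
      have \<epsilon>: "\<epsilon> \<in> cball 0 1"
        using w \<open>0 < \<rho>\<close> by (simp add: \<epsilon>_def norm_divide dist_norm norm_minus_commute)
      have "(deriv ^^ n) (extremal n z0 \<gamma> \<epsilon>) z0 = w"
        using deriv_eq[OF ex(1)[OF \<epsilon>]] ex(2)[OF \<epsilon>] \<open>0 < \<rho>\<close> by (simp add: \<epsilon>_def)
      then show "w \<in> {(deriv ^^ n) (extremal n z0 \<gamma> \<epsilon>) z0 | \<epsilon>. \<epsilon> \<in> cball 0 1}"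
        using \<epsilon> by blast
    qed
    have sub3: "{(deriv ^^ n) (extremal n z0 \<gamma> \<epsilon>) z0 | \<epsilon>. \<epsilon> \<in> cball 0 1} \<subseteq>
        {(deriv ^^ n) g z0 | g. g \<in> hyp_data_class n z0 \<gamma>}"
      using ex(1) by blast
    obtain h where h: "h \<in> class_S" "h z0 = hyp_deriv n f z0"
      "\<And>z. z \<in> ball 0 1 \<Longrightarrow> f z = nested_aut z0 (map \<gamma> [0..<n]) (h z) z"
      by (rule nested_aut_representation[OF z0 fS, of n \<gamma>]) (blast intro: f\<gamma> lt)+
    \<comment> \<open>Since \<open>\<rho> > 0\<close>, the affine map carries exactly the unit
      circle onto the boundary; unimodularity of \<open>h z0\<close> then makes \<open>h\<close>
      constant.\<close>
    have "(deriv ^^ n) f z0 \<in> sphere c \<rho> \<longleftrightarrow> cmod (hyp_deriv n f z0) = 1"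
      using deriv_eq[OF assms(4)] \<open>0 < \<rho>\<close> by (simp add: dist_norm norm_mult)
    also have "\<dots> \<longleftrightarrow> (\<exists>\<epsilon>\<in>sphere 0 1. \<forall>z\<in>ball 0 1. f z = extremal n z0 \<gamma> \<epsilon> z)"
    proof
      assume 1: "cmod (hyp_deriv n f z0) = 1"
      then have "h z = h z0" if "z \<in> ball 0 1" for z
        using class_S_constant[OF h(1) z0 _ that] h(2) by simp
      then have "\<forall>z\<in>ball 0 1. f z = extremal n z0 \<gamma> (h z0) z"
        using h(3) by (simp add: extremal_def)
      then show "\<exists>\<epsilon>\<in>sphere 0 1. \<forall>z\<in>ball 0 1. f z = extremal n z0 \<gamma> \<epsilon> z"
        using 1 h(2) by (intro bexI[of _ "h z0"]) auto
    next
      assume "\<exists>\<epsilon>\<in>sphere 0 1. \<forall>z\<in>ball 0 1. f z = extremal n z0 \<gamma> \<epsilon> z"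
      then obtain \<epsilon> where \<epsilon>: "cmod \<epsilon> = 1" "\<And>z. z \<in> ball 0 1 \<Longrightarrow> f z = extremal n z0 \<gamma> \<epsilon> z"
        by auto
      have "hyp_deriv n f z0 = hyp_deriv n (extremal n z0 \<gamma> \<epsilon>) z0"
        using \<epsilon>(2) z0 by (auto intro!: hyp_deriv_cong)
      then show "cmod (hyp_deriv n f z0) = 1" using ex(2)[of \<epsilon>] \<epsilon>(1) by simp
    qed
    finally have ?boundary by (simp only: c_def \<rho>_def)
    moreover have ?region ?extremal using sub1 sub2 sub3 unfolding c_def \<rho>_def by blast+
    moreover have ?form using h(1,3) by blast
    ultimately show "?region \<and> ?extremal \<and> ?form \<and> ?boundary" by blast
  qed
qed

end
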